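(* Let $F$ be a perfect idyll. The transpose of an $F$-morphism $\Phi:N\to M$ of $F$-matroids is an $F$-morphism $\Phi^t:M^\ast\to N^\ast$. This defines a contravariant endofunctor on $\mathrm{Mat}_F$ whose square is the identity.
   Context: An idyll is a commutative multiplicative monoid $F$ with an element $0$ satisfying $0\cdot a=0$ for all $a$ and such that $F^\times=F\setminus\{0\}$ is an abelian group, together with a subset $N_F$ (the nullset) of the group semiring $\mathbb N[F^\times]$ (where $0\in F$ is identified with the empty sum) such that $0\in N_F$, $1\notin N_F$, $N_F+N_F\subseteq N_F$, $\mathbb N[F^\times]\cdot N_F\subseteq N_F$, and there is a unique element $-1\in F^\times$ with $1+(-1)\in N_F$. Let $E$ be a finite set and $r\ge 0$. A Grassmann-Plücker function of rank $r$ on $E$ with coefficients in $F$ is a nonzero function $\varphi:E^r\to F$ that is alternating (i.e. $\varphi(x_{\sigma(1)},\dots,x_{\sigma(r)})=\mathrm{sign}(\sigma)\varphi(x_1,\dots,x_r)$ for all permutations $\sigma$, and $\varphi(x_1,\dots,x_r)=0$ if the $x_i$ are not pairwise distinct) and satisfies $\sum_{k=0}^r(-1)^k\varphi(y_0,\dots,\widehat{y_k},\dots,y_r)\varphi(y_k,x_2,\dots,x_r)\in N_F$ for all $x_2,\dots,x_r,y_0,\dots,y_r\in E$. An $F$-matroid of rank $r$ on $E$ is a class $M=[\varphi]$ of such functions up to multiplication by elements of $F^\times$. Dual: fix a total order on $E$ and let $n=\#E$; $M^*=[\varphi^*]$ with $\varphi^*:E^{n-r}\to F$, $\varphi^*(x)=0$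 if $x$ has repeated entries, and $\varphi^*(x)=\mathrm{sign}(x,x')\varphi(x')$ otherwise, where $x'\in E^r$ lists the complement of the entries of $x$ and $\mathrm{sign}(x,x')\in\{\pm1\}$ is the sign of the permutation sorting $(x,x')$ (this does not depend on the order, and $(M^* )^*=M$). Circuits: $\mathcal C_M\subseteq F^E$ consists of all $aX_y$ with $a\in F^\times$ and $y=(y_0,\dots,y_r)\in E^{r+1}$ with distinct entries and $\varphi(y_0,\dots,\widehat{y_k},\dots,y_r)\ne0$ for some $k$, where $X_y(y_i)=(-1)^i\varphi(y_0,\dots,\widehat{y_i},\dots,y_r)$ and $X_y(x)=0$ for other $x$. Cocircuits: $\mathcal C_M^*=\mathcal C_{M^*}$. For $X,Y\in F^E$ write $X\perp Y$ if $\sum_{e}X_eY_e\in N_F$. Vectors: $\mathcal V_M=\{X\in F^E: X\perp Y\ \forall Y\in\mathcal C_M^*\}$. Covectors: $\mathcal V_M^*=\{X\in F^E:X\perp Y\ \forall Y\in\mathcal C_M\}$. The idyll $F$ is perfect if $X\perp Y$ for all $F$-matroids $M$, $X\in\mathcal V_M$, $Y\in\mathcal V_M^*$. A submonomial $F$-matrix indexed by $T\times S$ (finite sets) is a matrix $\Phi=(\Phi_{i,j})_{(i,j)\in T\times S}$ with entries in $F$ such that each row and each column has at most one nonzero entry; it defines a map $F^S\to F^T$, $(\Phi\cdot X)_i=\sum_{j}\Phi_{i,j}X_j$ (at most one nonzero term). Its transpose $\Phi^t$ is indexed by $S\times T$. For $F$-matroids $N$ on $S$ and $M$ on $T$, an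 $F$-morphism $\Phi:N\to M$ is a submonomial $F$-matrix indexed by $T\times S$ with $\Phi\cdot\mathcal V_N\subseteq\mathcal V_M$. $\mathrm{Mat}_F$ is the category of $F$-matroids with $F$-morphisms, composed by matrix multiplication. *)

theory Defs
  imports "HOL-Library.Multiset" "HOL-Combinatorics.Permutations"
begin

section \<open>Idylls\<close>

text \<open>An element of the group semiring \<open>\<nat>[F\<^sup>\<times>]\<close> is a finite formal sum of nonzero elements, that is,
  a finite multiset not containing \<open>0\<close>: multiset union is addition, and \<open>{#}\<close> is the empty sum,
  with which \<open>0\<close> of \<open>F\<close> is identified.\<close>

definition (in times) formal_mult :: "'a multiset \<Rightarrow> 'a multiset \<Rightarrow> 'a multiset" where
  "formal_mult A B = \<Sum>\<^sub># (image_mset (\<lambda>a. image_mset (\<lambda>b. a * b) B) A)"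

definition formal_sum :: "('i \<Rightarrow> 'a::zero) \<Rightarrow> 'i set \<Rightarrow> 'a multiset" where
  "formal_sum f I = filter_mset (\<lambda>a. a \<noteq> 0) (image_mset f (mset_set I))"

text \<open>The first two axioms say that the nonzero elements form a group (in particular \<open>1 \<noteq> 0\<close>; closure
  under multiplication follows from the existence of inverses).\<close>

class idyll = comm_monoid_mult + mult_zero + zero_neq_one +
  fixes nullset :: "'a multiset set"
  assumes ex_inverse: "a \<noteq> 0 \<Longrightarrow> \<exists>b. a * b = 1"
    and nullset_nonzero: "A \<in> nullset \<Longrightarrow> 0 \<notin># A"
    and empty_in_nullset: "{#} \<in> nullset"
    and one_notin_nullset: "{#1#} \<notin> nullset"
    and nullset_add: "A \<in> nullset \<Longrightarrow> B \<in> nullset \<Longrightarrow> A + B \<in> nullset"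
    and nullset_mult: "0 \<notin># A \<Longrightarrow> B \<in> nullset \<Longrightarrow> formal_mult A B \<in> nullset"
    and ex1_neg_one: "\<exists>!e. e \<noteq> 0 \<and> {#1, e#} \<in> nullset"

definition neg_one :: "'a::idyll" where
  "neg_one = (THE e. e \<noteq> 0 \<and> {#1, e#} \<in> nullset)"

definition of_sign :: "int \<Rightarrow> 'a::idyll" where
  "of_sign s = (if s = 1 then 1 else neg_one)"

section \<open>Matroids over an idyll\<close>

text \<open>A function \<open>E\<^sup>r \<rightarrow> F\<close> is represented by a function on all lists that vanishes outside \<open>E\<^sup>r\<close>;
  likewise elements of \<open>F\<^sup>E\<close> and matrices vanish outside their index sets.\<close>

definition tuples :: "'e set \<Rightarrow> nat \<Rightarrow> 'e list set" where
  "tuples E r = {xs. set xs \<subseteq> E \<and> length xs = r}"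

definition omit :: "nat \<Rightarrow> 'e list \<Rightarrow> 'e list" where
  "omit k ys = take k ys @ drop (Suc k) ys"

definition alternating :: "'e set \<Rightarrow> nat \<Rightarrow> ('e list \<Rightarrow> 'a::idyll) \<Rightarrow> bool" where
  "alternating E r \<phi> \<longleftrightarrow>
     (\<forall>xs\<in>tuples E r. \<forall>\<sigma>. \<sigma> permutes {..<r} \<longrightarrow> \<phi> (permute_list \<sigma> xs) = of_sign (sign \<sigma>) * \<phi> xs) \<and>
     (\<forall>xs\<in>tuples E r. \<not> distinct xs \<longrightarrow> \<phi> xs = 0)"

text \<open>In the Grassmann--Pluecker relations \<open>xs\<close> is \<open>(x\<^sub>2, \<dots>, x\<^sub>r)\<close>; for \<open>r = 0\<close> there is no such
  tuple and the relations are vacuous.\<close>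

definition GP_function :: "'e set \<Rightarrow> nat \<Rightarrow> ('e list \<Rightarrow> 'a::idyll) \<Rightarrow> bool" where
  "GP_function E r \<phi> \<longleftrightarrow>
     (\<forall>xs. xs \<notin> tuples E r \<longrightarrow> \<phi> xs = 0) \<and>
     (\<exists>xs. \<phi> xs \<noteq> 0) \<and>
     alternating E r \<phi> \<and>
     (\<forall>xs ys. set xs \<subseteq> E \<and> length xs + 1 = r \<and> ys \<in> tuples E (r + 1) \<longrightarrow>
        formal_sum (\<lambda>k. neg_one ^ k * \<phi> (omit k ys) * \<phi> (ys ! k # xs)) {0..r} \<in> nullset)"

definition unit_class :: "('e list \<Rightarrow> 'a::idyll) \<Rightarrow> ('e list \<Rightarrow> 'a) set" where
  "unit_class \<phi> = {\<lambda>xs. a * \<phi> xs | a. a \<noteq> 0}"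

record ('e, 'a) matroid =
  ground :: "'e set"
  rank :: nat
  gp_class :: "('e list \<Rightarrow> 'a) set"

definition F_matroid :: "('e, 'a::idyll) matroid \<Rightarrow> bool" where
  "F_matroid M \<longleftrightarrow> finite (ground M) \<and>
     (\<exists>\<phi>. GP_function (ground M) (rank M) \<phi> \<and> gp_class M = unit_class \<phi>)"

subsection \<open>Duality\<close>

definition sort_sign :: "'e::linorder list \<Rightarrow> int" where
  "sort_sign xs = sign (THE p. p permutes {..<length xs} \<and> permute_list p xs = sort xs)"

definition dual_function ::
    "'e::linorder set \<Rightarrow> nat \<Rightarrow> ('e list \<Rightarrow> 'a::idyll) \<Rightarrow> 'e list \<Rightarrow> 'a" where
  "dual_function E r \<phi> xs =
     (if xs \<in> tuples E (card E - r) \<and> distinct xs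
      then let xs' = sorted_list_of_set (E - set xs) in of_sign (sort_sign (xs @ xs')) * \<phi> xs'
      else 0)"

text \<open>All representatives \<open>\<phi>\<close> of \<open>M\<close> yield the same class \<open>unit_class (dual_function E r \<phi>)\<close>.\<close>

definition dual :: "('e::linorder, 'a::idyll) matroid \<Rightarrow> ('e, 'a) matroid" where
  "dual M = \<lparr>ground = ground M, rank = card (ground M) - rank M,
     gp_class = (\<Union>\<phi>\<in>gp_class M. unit_class (dual_function (ground M) (rank M) \<phi>))\<rparr>"

subsection \<open>Circuits and vectors\<close>

definition fundamental_circuit :: "('e list \<Rightarrow> 'a::idyll) \<Rightarrow> 'e list \<Rightarrow> 'e \<Rightarrow> 'a" where
  "fundamental_circuit \<phi> ys e =
     (if e \<in> set ys
      then let i = (THE i. i < length ys \<and> ys ! i = e) in neg_one ^ i * \<phi> (omit i ys)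
      else 0)"

definition circuits :: "('e, 'a::idyll) matroid \<Rightarrow> ('e \<Rightarrow> 'a) set" where
  "circuits M = {\<lambda>e. a * fundamental_circuit \<phi> ys e | a \<phi> ys.
     a \<noteq> 0 \<and> \<phi> \<in> gp_class M \<and> ys \<in> tuples (ground M) (rank M + 1) \<and> distinct ys \<and>
     (\<exists>k\<le>rank M. \<phi> (omit k ys) \<noteq> 0)}"

definition cocircuits :: "('e::linorder, 'a::idyll) matroid \<Rightarrow> ('e \<Rightarrow> 'a) set" where
  "cocircuits M = circuits (dual M)"

definition vecs_on :: "'e set \<Rightarrow> ('e \<Rightarrow> 'a::zero) set" where
  "vecs_on E = {X. \<forall>e. e \<notin> E \<longrightarrow> X e = 0}"

definition orth :: "'e set \<Rightarrow> ('e \<Rightarrow> 'a::idyll) \<Rightarrow> ('e \<Rightarrow> 'a) \<Rightarrow> bool" where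
  "orth E X Y \<longleftrightarrow> formal_sum (\<lambda>e. X e * Y e) E \<in> nullset"

definition vectors :: "('e::linorder, 'a::idyll) matroid \<Rightarrow> ('e \<Rightarrow> 'a) set" where
  "vectors M = {X \<in> vecs_on (ground M). \<forall>Y\<in>cocircuits M. orth (ground M) X Y}"

definition covectors :: "('e, 'a::idyll) matroid \<Rightarrow> ('e \<Rightarrow> 'a) set" where
  "covectors M = {X \<in> vecs_on (ground M). \<forall>Y\<in>circuits M. orth (ground M) X Y}"

text \<open>HOL cannot quantify over types inside a formula, so perfectness ranges over all matroids on
  finite sets of natural numbers; every finite set is in bijection with such a set.\<close>

definition perfect_idyll :: "'a::idyll itself \<Rightarrow> bool" where
  "perfect_idyll _ \<longleftrightarrow>
     (\<forall>M :: (nat, 'a) matroid. F_matroid M \<longrightarrow>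
        (\<forall>X\<in>vectors M. \<forall>Y\<in>covectors M. orth (ground M) X Y))"

section \<open>Submonomial matrices and morphisms\<close>

text \<open>\<open>F\<close> has no addition; a sum with at most one nonzero term is that term, or \<open>0\<close>.
  (Sums with several nonzero terms are given the junk value \<open>0\<close>; they do not occur below.)\<close>

definition single_sum :: "('i \<Rightarrow> 'a::zero) \<Rightarrow> 'i set \<Rightarrow> 'a" where
  "single_sum f I =
     (if \<exists>!j. j \<in> I \<and> f j \<noteq> 0 then f (THE j. j \<in> I \<and> f j \<noteq> 0) else 0)"

definition submonomial :: "'t set \<Rightarrow> 's set \<Rightarrow> ('t \<Rightarrow> 's \<Rightarrow> 'a::zero) \<Rightarrow> bool" where
  "submonomial T S \<Phi> \<longleftrightarrow>
     (\<forall>i j. (i, j) \<notin> T \<times> S \<longrightarrow> \<Phi> i j = 0) \<and>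
     (\<forall>i\<in>T. \<exists>\<^sub>\<le>\<^sub>1j. \<Phi> i j \<noteq> 0) \<and>
     (\<forall>j\<in>S. \<exists>\<^sub>\<le>\<^sub>1i. \<Phi> i j \<noteq> 0)"

definition mat_apply :: "'s set \<Rightarrow> ('t \<Rightarrow> 's \<Rightarrow> 'a::mult_zero) \<Rightarrow> ('s \<Rightarrow> 'a) \<Rightarrow> 't \<Rightarrow> 'a" where
  "mat_apply S \<Phi> X i = single_sum (\<lambda>j. \<Phi> i j * X j) S"

definition mat_mult ::
    "'t set \<Rightarrow> ('u \<Rightarrow> 't \<Rightarrow> 'a::mult_zero) \<Rightarrow> ('t \<Rightarrow> 's \<Rightarrow> 'a) \<Rightarrow> 'u \<Rightarrow> 's \<Rightarrow> 'a" where
  "mat_mult T \<Psi> \<Phi> i k = single_sum (\<lambda>j. \<Psi> i j * \<Phi> j k) T"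

definition mat_id :: "'s set \<Rightarrow> 's \<Rightarrow> 's \<Rightarrow> 'a::zero_neq_one" where
  "mat_id S i j = (if i \<in> S \<and> i = j then 1 else 0)"

definition mat_transpose :: "('t \<Rightarrow> 's \<Rightarrow> 'a) \<Rightarrow> 's \<Rightarrow> 't \<Rightarrow> 'a" where
  "mat_transpose \<Phi> j i = \<Phi> i j"

definition F_morphism ::
    "('s::linorder, 'a::idyll) matroid \<Rightarrow> ('t::linorder, 'a) matroid \<Rightarrow> ('t \<Rightarrow> 's \<Rightarrow> 'a) \<Rightarrow> bool" where
  "F_morphism N M \<Phi> \<longleftrightarrow> F_matroid N \<and> F_matroid M \<and> submonomial (ground M) (ground N) \<Phi> \<and>
     mat_apply (ground N) \<Phi> ` vectors N \<subseteq> vectors M"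

section \<open>Categories\<close>

text \<open>Hom-sets are indexed by source and target and need not be disjoint; composition therefore
  takes the three objects involved as arguments: \<open>composite C X Y Z g f\<close> is \<open>g \<circ> f\<close> for
  \<open>f : X \<rightarrow> Y\<close> and \<open>g : Y \<rightarrow> Z\<close>.\<close>

record ('o, 'm) category_data =
  obj :: "'o set"
  hom :: "'o \<Rightarrow> 'o \<Rightarrow> 'm set"
  ident :: "'o \<Rightarrow> 'm"
  composite :: "'o \<Rightarrow> 'o \<Rightarrow> 'o \<Rightarrow> 'm \<Rightarrow> 'm \<Rightarrow> 'm"

locale category =
  fixes C :: "('o, 'm) category_data"
  assumes ident_hom: "X \<in> obj C \<Longrightarrow> ident C X \<in> hom C X X"
    and comp_hom: "\<lbrakk>X \<in> obj C; Y \<in> obj C; Z \<in> obj C; f \<in> hom C X Y; g \<in> hom C Y Z\<rbrakk>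
      \<Longrightarrow> composite C X Y Z g f \<in> hom C X Z"
    and comp_ident_right: "\<lbrakk>X \<in> obj C; Y \<in> obj C; f \<in> hom C X Y\<rbrakk>
      \<Longrightarrow> composite C X X Y f (ident C X) = f"
    and comp_ident_left: "\<lbrakk>X \<in> obj C; Y \<in> obj C; f \<in> hom C X Y\<rbrakk>
      \<Longrightarrow> composite C X Y Y (ident C Y) f = f"
    and comp_assoc: "\<lbrakk>W \<in> obj C; X \<in> obj C; Y \<in> obj C; Z \<in> obj C;
        f \<in> hom C W X; g \<in> hom C X Y; h \<in> hom C Y Z\<rbrakk>
      \<Longrightarrow> composite C W Y Z h (composite C W X Y g f) = composite C W X Z (composite C X Y Z h g) f"

locale contravariant_functor = C: category C + D: category D
  for C :: "('o, 'm) category_data" and D :: "('p, 'n) category_data" +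
  fixes F\<^sub>0 :: "'o \<Rightarrow> 'p" and F\<^sub>1 :: "'o \<Rightarrow> 'o \<Rightarrow> 'm \<Rightarrow> 'n"
  assumes map_obj: "X \<in> obj C \<Longrightarrow> F\<^sub>0 X \<in> obj D"
    and map_hom: "\<lbrakk>X \<in> obj C; Y \<in> obj C; f \<in> hom C X Y\<rbrakk> \<Longrightarrow> F\<^sub>1 X Y f \<in> hom D (F\<^sub>0 Y) (F\<^sub>0 X)"
    and map_ident: "X \<in> obj C \<Longrightarrow> F\<^sub>1 X X (ident C X) = ident D (F\<^sub>0 X)"
    and map_comp: "\<lbrakk>X \<in> obj C; Y \<in> obj C; Z \<in> obj C; f \<in> hom C X Y; g \<in> hom C Y Z\<rbrakk>
      \<Longrightarrow> F\<^sub>1 X Z (composite C X Y Z g f) = composite D (F\<^sub>0 Z) (F\<^sub>0 Y) (F\<^sub>0 X) (F\<^sub>1 X Y f) (F\<^sub>1 Y Z g)"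

definition squares_to_identity ::
    "('o, 'm) category_data \<Rightarrow> ('o \<Rightarrow> 'o) \<Rightarrow> ('o \<Rightarrow> 'o \<Rightarrow> 'm \<Rightarrow> 'm) \<Rightarrow> bool" where
  "squares_to_identity C F\<^sub>0 F\<^sub>1 \<longleftrightarrow>
     (\<forall>X\<in>obj C. F\<^sub>0 (F\<^sub>0 X) = X) \<and>
     (\<forall>X\<in>obj C. \<forall>Y\<in>obj C. \<forall>f\<in>hom C X Y. F\<^sub>1 (F\<^sub>0 Y) (F\<^sub>0 X) (F\<^sub>1 X Y f) = f)"

definition Mat :: "(('e::linorder, 'a::idyll) matroid, 'e \<Rightarrow> 'e \<Rightarrow> 'a) category_data" where
  "Mat = \<lparr>obj = {M. F_matroid M},
     hom = (\<lambda>N M. {\<Phi>. F_morphism N M \<Phi>}),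
     ident = (\<lambda>M. mat_id (ground M)),
     composite = (\<lambda>L N M \<Psi> \<Phi>. mat_mult (ground N) \<Psi> \<Phi>)\<rparr>"

end

theory Submission
  imports Defs
begin

text \<open>
  The proof is an adjunction argument. For a submonomial matrix \<open>\<Phi>\<close> from \<open>F\<^sup>S\<close> to \<open>F\<^sup>T\<close> the relations
  \<open>\<Phi> X \<perp> Y\<close> and \<open>X \<perp> \<Phi>\<^sup>t Y\<close> are the same, because the nonzero entries of \<open>\<Phi>\<close> form a partial bijection
  between \<open>S\<close> and \<open>T\<close> and both relations compare the formal sum of the terms \<open>\<Phi>\<^sub>i\<^sub>j X\<^sub>j Y\<^sub>i\<close> over
  this bijection with the nullset (\<open>orth_mat_apply\<close>). Since \<open>M\<^sup>*\<^sup>* = M\<close>, the vectors of \<open>M\<^sup>*\<close> are the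
  covectors of \<open>M\<close>; the claim therefore is that \<open>\<Phi>\<^sup>t\<close> carries a covector \<open>Y\<close> of \<open>M\<close> to a covector of
  \<open>N\<close>, that is, \<open>C \<perp> \<Phi>\<^sup>t Y\<close> for every circuit \<open>C\<close> of \<open>N\<close>. A circuit is a vector, so \<open>\<Phi> C\<close> is a
  vector of \<open>M\<close>, and perfectness gives \<open>\<Phi> C \<perp> Y\<close>. Functoriality is then formal: products of submonomial
  matrices behave like composition of maps, transposition reverses them, and it is an involution.

  The remaining work is the theory of the dual Grassmann--Pluecker function \<open>\<phi>\<^sup>*\<close>. Three facts are needed:
  \<open>\<phi>\<^sup>*\<close> satisfies the Grassmann--Pluecker relations, \<open>\<phi>\<^sup>*\<^sup>*\<close> agrees with \<open>\<phi>\<close> up to a global sign, and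
  circuits are orthogonal to cocircuits. The second is the sign of exchanging two blocks of a list; the
  others rest on one identity (\<open>fundamental_circuit_dual_function\<close>): if \<open>us\<close> lists the complement of \<open>zs\<close>, then the fundamental
  circuit of \<open>\<phi>\<^sup>*\<close> at \<open>zs\<close> is, up to a sign, the function sending \<open>e\<close> to \<open>\<phi> (e, us)\<close>. A
  Grassmann--Pluecker relation with distinct indices says exactly that a fundamental circuit is orthogonal
  to such a function, so in this form the relations are symmetric under duality, circuits are visibly
  vectors, and the set of vectors has a description without any ordering of the ground set
  (\<open>vectors_iff\<close>). The last point allows perfectness, which speaks about matroids on natural numbers, to
  be carried to an arbitrary finite ground set along any injection.
\<close>

section \<open>Arithmetic in an idyll\<close>

lemma idyll_mult_eq_0_iff [simp]:
  fixes a b :: "'a::idyll"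
  shows "a * b = 0 \<longleftrightarrow> a = 0 \<or> b = 0"
proof -
  have "b = 0" if "a * b = 0" "a \<noteq> 0"
  proof -
    obtain c where c: "a * c = 1" using ex_inverse[OF \<open>a \<noteq> 0\<close>] by blast
    have "b = (a * b) * c" using c by (metis mult.assoc mult.commute mult_1)
    then show ?thesis using that by simp
  qed
  then show ?thesis by auto
qed

lemma nullset_scale:
  fixes c :: "'a::idyll"
  assumes "A \<in> nullset" "c \<noteq> 0"
  shows "image_mset ((*) c) A \<in> nullset"
  using nullset_mult[of "{#c#}" A] assms by (simp add: formal_mult_def)

lemma neg_one_nonzero [simp]: "neg_one \<noteq> (0::'a::idyll)"
  and neg_one_null: "{#1, neg_one#} \<in> (nullset :: 'a::idyll multiset set)"
  using theI'[OF ex1_neg_one[where 'a='a]] unfolding neg_one_def by auto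

text \<open>Scaling the null sum \<open>1 + (-1)\<close> by the inverse of \<open>-1\<close> shows that this inverse is again a
  negative of \<open>1\<close>; uniqueness of the negative identifies it with \<open>-1\<close>.\<close>

lemma neg_one_square [simp]: "neg_one * neg_one = (1::'a::idyll)"
proof -
  obtain c :: 'a where c: "neg_one * c = 1" using ex_inverse[OF neg_one_nonzero] by blast
  then have "c \<noteq> 0" by auto
  then have "image_mset ((*) c) {#1, neg_one#} \<in> nullset" by (intro nullset_scale neg_one_null)
  then have "{#1, c#} \<in> nullset" using c by (simp add: mult.commute add_mset_commute)
  with \<open>c \<noteq> 0\<close> have "c = neg_one"
    using ex1_neg_one[where 'a='a] neg_one_null neg_one_nonzero by blast
  with c show ?thesis by simp
qed

lemma neg_one_power_nonzero [simp]: "neg_one ^ k \<noteq> (0::'a::idyll)"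
  by (induction k) auto

lemma neg_one_power_square [simp]: "neg_one ^ k * neg_one ^ k = (1::'a::idyll)"
  by (simp flip: power_mult_distrib)

lemma neg_one_power_left_cancel [simp]: "neg_one ^ k * (neg_one ^ k * a) = (a::'a::idyll)"
  by (simp flip: mult.assoc)

lemma of_sign_nonzero [simp]: "of_sign s \<noteq> (0::'a::idyll)"
  by (simp add: of_sign_def)

lemma of_sign_square [simp]: "of_sign s * of_sign s = (1::'a::idyll)"
  by (simp add: of_sign_def)

lemma of_sign_left_cancel [simp]: "of_sign s * (of_sign s * a) = (a::'a::idyll)"
  by (simp flip: mult.assoc)

lemma of_sign_mult:
  assumes "s \<in> {1, -1}" "t \<in> {1, -1}"
  shows "of_sign (s * t) = (of_sign s * of_sign t :: 'a::idyll)"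
  using assms by (auto simp: of_sign_def)

lemma of_sign_power: "of_sign ((-1) ^ k) = (neg_one ^ k :: 'a::idyll)"
proof (induction k)
  case (Suc k)
  have "(-1) ^ k \<in> {1, -1::int}" by (cases "even k") auto
  then show ?case using of_sign_mult[of "-1" "(-1) ^ k", where 'a='a] Suc
    by (simp add: of_sign_def)
qed (simp add: of_sign_def)

lemma of_sign_power_mult:
  assumes "s \<in> {1, -1}"
  shows "of_sign ((-1) ^ k * s) = (neg_one ^ k * of_sign s :: 'a::idyll)"
proof -
  have "(-1) ^ k \<in> {1, -1::int}" by (cases "even k") auto
  from of_sign_mult[OF this assms] show ?thesis by (simp add: of_sign_power)
qed

section \<open>Formal sums and orthogonality\<close>

lemma formal_sum_cong:
  assumes "\<And>i. i \<in> I \<Longrightarrow> f i = g i"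
  shows "formal_sum f I = formal_sum g I"
proof (cases "finite I")
  case True
  then show ?thesis unfolding formal_sum_def
    using assms by (intro arg_cong[where f="filter_mset _"] image_mset_cong) auto
qed (simp add: formal_sum_def)

lemma formal_sum_zero:
  assumes "\<And>i. i \<in> I \<Longrightarrow> f i = 0"
  shows "formal_sum f I = {#}"
proof -
  have "formal_sum f I = formal_sum (\<lambda>_. 0) I" using assms by (rule formal_sum_cong)
  then show ?thesis by (simp add: formal_sum_def filter_mset_image_mset)
qed

lemma formal_sum_superset:
  assumes "finite I" "J \<subseteq> I" "\<And>i. i \<in> I - J \<Longrightarrow> f i = 0"
  shows "formal_sum f I = formal_sum f J"
proof -
  have "mset_set I = mset_set J + mset_set (I - J)"
    using assms(1,2) by (metis Diff_disjoint Un_Diff_cancel finite_Diff finite_subset mset_set_Union sup.absorb2)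
  then have "formal_sum f I = formal_sum f J + formal_sum f (I - J)" by (simp add: formal_sum_def)
  then show ?thesis using formal_sum_zero[of "I - J" f] assms(3) by simp
qed

lemma formal_sum_image:
  assumes "inj_on h I"
  shows "formal_sum f (h ` I) = formal_sum (\<lambda>i. f (h i)) I"
  using assms by (simp add: formal_sum_def image_mset_mset_set[symmetric] multiset.map_comp comp_def)

lemma formal_sum_scale_null:
  fixes c :: "'a::idyll"
  assumes "formal_sum f I \<in> nullset"
  shows "formal_sum (\<lambda>i. c * f i) I \<in> nullset"
proof (cases "c = 0")
  case True
  then show ?thesis by (simp add: formal_sum_zero empty_in_nullset)
next
  case False
  then have "formal_sum (\<lambda>i. c * f i) I = image_mset ((*) c) (formal_sum f I)"
    by (simp add: formal_sum_def filter_mset_image_mset multiset.map_comp comp_def)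
  then show ?thesis using nullset_scale[OF assms False] by simp
qed

text \<open>This is what makes the Grassmann--Pluecker relations with a repeated index automatic.\<close>

lemma formal_sum_opposite_pair:
  fixes f :: "'i \<Rightarrow> 'a::idyll"
  assumes "finite I" "i \<in> I" "j \<in> I" "i \<noteq> j" "f j = neg_one * f i"
    and "\<And>k. k \<in> I \<Longrightarrow> k \<noteq> i \<Longrightarrow> k \<noteq> j \<Longrightarrow> f k = 0"
  shows "formal_sum f I \<in> nullset"
proof -
  have "formal_sum f I = formal_sum f {i, j}"
    by (rule formal_sum_superset) (use assms in auto)
  also have "\<dots> = formal_sum (\<lambda>k. f i * (if k = i then 1 else neg_one)) {i, j}"
    using assms by (intro formal_sum_cong) (auto simp: mult.commute)
  also have "\<dots> \<in> nullset"
  proof (rule formal_sum_scale_null)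
    show "formal_sum (\<lambda>k. if k = i then 1 else neg_one) {i, j} \<in> (nullset :: 'a multiset set)"
      using assms(4) neg_one_null by (simp add: formal_sum_def)
  qed
  finally show ?thesis .
qed

lemma orth_cong:
  assumes "\<And>e. e \<in> E \<Longrightarrow> X e = X' e" "\<And>e. e \<in> E \<Longrightarrow> Y e = Y' e"
  shows "orth E X Y = orth E X' Y'"
  unfolding orth_def using assms formal_sum_cong[of E "\<lambda>e. X e * Y e" "\<lambda>e. X' e * Y' e"] by simp

lemma orth_commute: "orth E X Y = orth E Y X"
  by (simp add: orth_def mult.commute)

lemma orth_scale:
  assumes "orth E X Y"
  shows "orth E (\<lambda>e. a * X e) (\<lambda>e. b * Y e)"
  using formal_sum_scale_null[of "\<lambda>e. X e * Y e" E "a * b"] assms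
  by (simp add: orth_def mult.assoc mult.left_commute)

lemma orth_zero_right:
  assumes "\<And>e. e \<in> E \<Longrightarrow> Y e = 0"
  shows "orth E X Y"
  unfolding orth_def using assms by (simp add: formal_sum_zero empty_in_nullset)

section \<open>Signs of orderings\<close>

lemma sign_in_pm1: "sign p \<in> {1, -1}"
  by (simp add: sign_def)

lemma sort_sign_in_pm1: "sort_sign xs \<in> {1, -1}"
  unfolding sort_sign_def by (rule sign_in_pm1)

lemma permute_list_inj:
  assumes "distinct xs" "p permutes {..<length xs}" "q permutes {..<length xs}"
    and "permute_list p xs = permute_list q xs"
  shows "p = q"
proof
  fix i
  show "p i = q i"
  proof (cases "i < length xs")
    case True
    then have "xs ! p i = xs ! q i" using assms by (metis permute_list_nth)
    moreover have "p i < length xs" "q i < length xs"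
      using True permutes_in_image[OF assms(2)] permutes_in_image[OF assms(3)] by auto
    ultimately show ?thesis using assms(1) by (simp add: nth_eq_iff_index_eq)
  next
    case False
    then show ?thesis using assms(2,3) by (simp add: permutes_def)
  qed
qed

lemma sort_sign_eqI:
  assumes "distinct xs" "p permutes {..<length xs}" "permute_list p xs = sort xs"
  shows "sort_sign xs = sign p"
proof -
  have "(THE p. p permutes {..<length xs} \<and> permute_list p xs = sort xs) = p"
    using assms by (intro the_equality) (auto intro: permute_list_inj)
  then show ?thesis by (simp add: sort_sign_def)
qed

text \<open>If \<open>q\<close> sorts the permuted list, then \<open>p \<circ> q\<close> sorts the original one.\<close>

lemma sort_sign_permute:
  assumes "distinct xs" "p permutes {..<length xs}"
  shows "sort_sign (permute_list p xs) = sign p * sort_sign xs"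
proof -
  let ?ys = "permute_list p xs"
  obtain q where q: "q permutes {..<length ?ys}" "permute_list q ?ys = sort xs"
    using mset_eq_permutation[of "sort xs" ?ys] assms(2) by (metis mset_permute_list mset_sort)
  have srt: "sort ?ys = sort xs" using assms(2) by (intro properties_for_sort) (auto)
  have "sort_sign ?ys = sign q"
    using assms q srt by (intro sort_sign_eqI) auto
  moreover have "sort_sign xs = sign (p \<circ> q)"
    using assms q by (intro sort_sign_eqI) (auto simp: permutes_compose permute_list_compose)
  moreover have "sign (p \<circ> q) = sign p * sign q"
    using assms(2) q(1) by (intro sign_compose) (auto intro: permutes_imp_permutation[rotated])
  ultimately show ?thesis by simp
qed

lemma permute_list_transpose_adjacent:
  "permute_list (transpose (length us) (Suc (length us))) (us @ a # b # vs) = us @ b # a # vs"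
proof (rule nth_equalityI)
  let ?t = "transpose (length us) (Suc (length us))"
  let ?l = "us @ a # b # vs"
  have t: "?t permutes {..<length ?l}" by (rule permutes_swap_id) auto
  fix i assume i: "i < length (permute_list ?t ?l)"
  then have "permute_list ?t ?l ! i = ?l ! ?t i" using t by (simp add: permute_list_nth)
  also have "\<dots> = (us @ b # a # vs) ! i"
    using i by (auto simp: transpose_def nth_append nth_Cons split: nat.splits) 
  finally show "permute_list ?t ?l ! i = (us @ b # a # vs) ! i" .
qed simp

text \<open>The cycle is built from adjacent transpositions. Providing it as a permutation lets the same fact
  serve both for \<open>sort_sign\<close> and for alternating functions.\<close>

lemma ex_permutation_move_head:
  "\<exists>\<sigma>. \<sigma> permutes {..<Suc (length us)} \<and> sign \<sigma> = (-1) ^ length us \<and>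
      (\<forall>vs. permute_list \<sigma> (a # us @ vs) = us @ a # vs)"
proof (induction us rule: rev_induct)
  case Nil
  then show ?case by (intro exI[of _ "\<lambda>x. x"]) (simp add: permutes_def)
next
  case (snoc b us)
  then obtain \<sigma> where \<sigma>: "\<sigma> permutes {..<Suc (length us)}" "sign \<sigma> = (-1) ^ length us"
    "\<And>vs. permute_list \<sigma> (a # us @ vs) = us @ a # vs" by blast
  let ?t = "transpose (length us) (Suc (length us))"
  have t: "?t permutes {..<Suc (length (us @ [b]))}" by (rule permutes_swap_id) auto
  have \<sigma>': "\<sigma> permutes {..<Suc (length (us @ [b]))}"
    by (rule permutes_subset[OF \<sigma>(1)]) auto
  have "sign (\<sigma> \<circ> ?t) = sign \<sigma> * sign ?t"
    using \<sigma>' t by (intro sign_compose) (auto intro: permutes_imp_permutation[rotated])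
  then have "sign (\<sigma> \<circ> ?t) = (-1) ^ length (us @ [b])" using \<sigma>(2) by (simp add: sign_swap_id)
  moreover have "permute_list (\<sigma> \<circ> ?t) (a # (us @ [b]) @ vs) = (us @ [b]) @ a # vs" for vs
  proof -
    have "?t permutes {..<length (a # (us @ [b]) @ vs)}" by (rule permutes_subset[OF t]) auto
    then have "permute_list (\<sigma> \<circ> ?t) (a # (us @ [b]) @ vs)
        = permute_list ?t (permute_list \<sigma> (a # us @ (b # vs)))"
      by (subst permute_list_compose) auto
    then show ?thesis by (simp add: \<sigma>(3) permute_list_transpose_adjacent)
  qed
  ultimately show ?case using permutes_compose[OF t \<sigma>'] by blast
qed

lemma sort_sign_move_head:
  assumes "distinct (us @ a # vs)"
  shows "sort_sign (us @ a # vs) = (-1) ^ length us * sort_sign (a # us @ vs)"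
proof -
  obtain \<sigma> where \<sigma>: "\<sigma> permutes {..<Suc (length us)}" "sign \<sigma> = (-1) ^ length us"
    "permute_list \<sigma> (a # us @ vs) = us @ a # vs" using ex_permutation_move_head by metis
  have "\<sigma> permutes {..<length (a # us @ vs)}" by (rule permutes_subset[OF \<sigma>(1)]) auto
  then show ?thesis using sort_sign_permute[of "a # us @ vs" \<sigma>] assms \<sigma> by auto
qed

lemma sort_sign_swap_blocks:
  assumes "distinct (xs @ ys)"
  shows "sort_sign (xs @ ys) = (-1) ^ (length xs * length ys) * sort_sign (ys @ xs)"
  using assms
proof (induction xs arbitrary: ys)
  case (Cons x xs)
  \<comment> \<open>Carry \<open>x\<close> past both blocks to the end, then exchange \<open>xs\<close> with \<open>ys @ [x]\<close>.\<close>
  have "sort_sign (xs @ (ys @ [x])) = (-1) ^ (length xs * length (ys @ [x])) * sort_sign ((ys @ [x]) @ xs)"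
    using Cons.prems by (intro Cons.IH) auto
  moreover have "sort_sign ((xs @ ys) @ x # []) = (-1) ^ length (xs @ ys) * sort_sign (x # xs @ ys)"
    using Cons.prems sort_sign_move_head[of "xs @ ys" x "[]"] by auto
  moreover have "(-1::int) ^ k * (-1) ^ k = 1" for k by (simp flip: power_mult_distrib)
  ultimately have "sort_sign (x # xs @ ys) = (-1) ^ length (xs @ ys) *
      ((-1) ^ (length xs * length (ys @ [x])) * sort_sign (ys @ x # xs))"
    by (metis append.assoc append_Cons append_Nil mult.assoc mult_1)
  moreover have "(-1::int) ^ length (xs @ ys) * (-1) ^ (length xs * length (ys @ [x]))
      = (-1) ^ (length (x # xs) * length ys)"
    by (auto simp: minus_one_power_iff)
  ultimately show ?case by (metis append_Cons mult.assoc)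
qed simp

lemma permute_list_append_left:
  assumes "p permutes {..<length xs}"
  shows "permute_list p (xs @ ys) = permute_list p xs @ ys"
proof (rule nth_equalityI)
  have p: "p permutes {..<length (xs @ ys)}" by (rule permutes_subset[OF assms]) auto
  fix i assume i: "i < length (permute_list p (xs @ ys))"
  show "permute_list p (xs @ ys) ! i = (permute_list p xs @ ys) ! i"
  proof (cases "i < length xs")
    case True
    then have "p i < length xs" using permutes_in_image[OF assms, of i] by simp
    then show ?thesis using True i p assms by (simp add: permute_list_nth nth_append)
  next
    case False
    then have "p i = i" using assms by (simp add: permutes_def)
    then show ?thesis using False i p by (simp add: permute_list_nth nth_append)
  qed
qed simp

lemma sort_sign_permute_left:
  assumes "distinct (xs @ ys)" "p permutes {..<length xs}"
  shows "sort_sign (permute_list p xs @ ys) = sign p * sort_sign (xs @ ys)"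
proof -
  have "p permutes {..<length (xs @ ys)}" by (rule permutes_subset[OF assms(2)]) auto
  then show ?thesis
    using sort_sign_permute[OF assms(1), of p] permute_list_append_left[OF assms(2)] by simp
qed

text \<open>A permutation of the right block acts on shifted positions; exchanging the two blocks before and
  after reduces to the left block, and the two block signs cancel.\<close>

lemma sort_sign_permute_right:
  assumes "distinct (xs @ ys)" "p permutes {..<length ys}"
  shows "sort_sign (xs @ permute_list p ys) = sign p * sort_sign (xs @ ys)"
proof -
  have "distinct (ys @ xs)" "distinct (xs @ permute_list p ys)"
    using assms by auto
  then show ?thesis
    using sort_sign_swap_blocks[of xs "permute_list p ys"] sort_sign_swap_blocks[of xs ys]
      sort_sign_permute_left[of ys xs p] assms by simp
qed

lemma of_sign_sort_sign_move_head:
  assumes "distinct (us @ a # vs)"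
  shows "of_sign (sort_sign (us @ a # vs)) = (neg_one ^ length us * of_sign (sort_sign (a # us @ vs)) :: 'a::idyll)"
  unfolding sort_sign_move_head[OF assms] by (rule of_sign_power_mult[OF sort_sign_in_pm1])

section \<open>Fundamental circuits and the Grassmann--Pluecker relations\<close>

lemma omit_append: "omit (length us) (us @ a # vs) = us @ vs"
  by (simp add: omit_def)

lemma length_omit: "k < length ys \<Longrightarrow> length (omit k ys) = length ys - 1"
  by (simp add: omit_def)

lemma set_omit_subset: "set (omit k ys) \<subseteq> set ys"
  by (auto simp: omit_def dest: in_set_takeD in_set_dropD)

lemma map_omit: "map g (omit k ys) = omit k (map g ys)"
  by (simp add: omit_def take_map drop_map)

lemma fundamental_circuit_nth:
  assumes "distinct ys" "k < length ys"
  shows "fundamental_circuit \<phi> ys (ys ! k) = neg_one ^ k * \<phi> (omit k ys)"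
proof -
  have "(THE i. i < length ys \<and> ys ! i = ys ! k) = k"
    using assms by (intro the_equality) (auto simp: nth_eq_iff_index_eq)
  then show ?thesis using assms by (simp add: fundamental_circuit_def)
qed

lemma fundamental_circuit_outside: "e \<notin> set ys \<Longrightarrow> fundamental_circuit \<phi> ys e = 0"
  by (simp add: fundamental_circuit_def)

lemma fundamental_circuit_append:
  assumes "distinct (us @ e # vs)"
  shows "fundamental_circuit \<phi> (us @ e # vs) e = neg_one ^ length us * \<phi> (us @ vs)"
  using fundamental_circuit_nth[OF assms, of "length us" \<phi>] by (simp add: omit_append)

text \<open>A fundamental circuit is supported on \<open>ys\<close>, so its orthogonality relations can be summed over the
  positions in \<open>ys\<close>. This is the shape of the Grassmann--Pluecker relations.\<close>

lemma orth_fundamental_circuit_iff: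
  assumes "finite E" "distinct ys" "ys \<in> tuples E (r + 1)"
  shows "orth E (fundamental_circuit \<phi> ys) Y \<longleftrightarrow>
    formal_sum (\<lambda>k. neg_one ^ k * \<phi> (omit k ys) * Y (ys ! k)) {0..r} \<in> nullset"
proof -
  have len: "length ys = Suc r" and sub: "set ys \<subseteq> E" using assms(3) by (auto simp: tuples_def)
  have im: "set ys = (!) ys ` {0..r}"
    using len by (auto simp: set_conv_nth image_def less_Suc_eq_le)
  have inj: "inj_on ((!) ys) {0..r}"
    using assms(2) len by (intro inj_on_nth) auto
  have "formal_sum (\<lambda>e. fundamental_circuit \<phi> ys e * Y e) E
      = formal_sum (\<lambda>e. fundamental_circuit \<phi> ys e * Y e) ((!) ys ` {0..r})"
    unfolding im[symmetric]
    using assms(1) sub by (intro formal_sum_superset) (auto simp: fundamental_circuit_outside)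
  also have "\<dots> = formal_sum (\<lambda>k. neg_one ^ k * \<phi> (omit k ys) * Y (ys ! k)) {0..r}"
    unfolding formal_sum_image[OF inj]
    using assms(2) len by (intro formal_sum_cong) (simp add: fundamental_circuit_nth)
  finally show ?thesis by (simp add: orth_def)
qed

lemma alternating_move_head:
  assumes "alternating E r \<phi>" "us @ a # vs \<in> tuples E r"
  shows "\<phi> (us @ a # vs) = neg_one ^ length us * \<phi> (a # us @ vs)"
proof -
  obtain \<sigma> where \<sigma>: "\<sigma> permutes {..<Suc (length us)}" "sign \<sigma> = (-1) ^ length us"
    "permute_list \<sigma> (a # us @ vs) = us @ a # vs" using ex_permutation_move_head by metis
  have "\<sigma> permutes {..<r}"
    using assms(2) by (intro permutes_subset[OF \<sigma>(1)]) (auto simp: tuples_def)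
  moreover have "a # us @ vs \<in> tuples E r" using assms(2) by (auto simp: tuples_def)
  ultimately have "\<phi> (permute_list \<sigma> (a # us @ vs)) = of_sign (sign \<sigma>) * \<phi> (a # us @ vs)"
    using assms(1) unfolding alternating_def by blast
  then show ?thesis using \<sigma> by (simp add: of_sign_power)
qed

lemma GP_functionD:
  assumes "GP_function E r \<phi>"
  shows "xs \<notin> tuples E r \<Longrightarrow> \<phi> xs = 0" "\<exists>xs. \<phi> xs \<noteq> 0" "alternating E r \<phi>"
    "\<not> distinct xs \<Longrightarrow> \<phi> xs = 0"
  using assms unfolding GP_function_def alternating_def by blast+

lemma GP_function_orth:
  assumes "GP_function E r \<phi>" "finite E" "distinct ys" "ys \<in> tuples E (r + 1)"
    and "set xs \<subseteq> E" "length xs + 1 = r"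
  shows "orth E (fundamental_circuit \<phi> ys) (\<lambda>e. \<phi> (e # xs))"
  unfolding orth_fundamental_circuit_iff[OF assms(2-4)]
  using assms(1,4-6) unfolding GP_function_def by blast

text \<open>Only the relations with distinct \<open>xs\<close> and distinct \<open>ys\<close> carry content. If \<open>xs\<close> has a repetition,
  all terms vanish. If \<open>ys\<close> repeats an entry at positions \<open>i\<close> and \<open>j\<close>, then omitting any other
  position leaves the repetition in place, and the two surviving terms are negatives of each other.\<close>

lemma GP_functionI:
  assumes "finite E" "\<And>xs. xs \<notin> tuples E r \<Longrightarrow> \<phi> xs = 0" "\<exists>xs. \<phi> xs \<noteq> 0"
    and alt: "alternating E r \<phi>"
    and orth: "\<And>xs ys. \<lbrakk>distinct xs; set xs \<subseteq> E; length xs + 1 = r; distinct ys; ys \<in> tuples E (r + 1)\<rbrakk>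
      \<Longrightarrow> orth E (fundamental_circuit \<phi> ys) (\<lambda>e. \<phi> (e # xs))"
  shows "GP_function E r \<phi>"
proof -
  have zero: "\<phi> xs = 0" if "\<not> distinct xs" for xs
    using that assms(2) alt unfolding alternating_def by blast
  have "formal_sum (\<lambda>k. neg_one ^ k * \<phi> (omit k ys) * \<phi> (ys ! k # xs)) {0..r} \<in> nullset"
    if *: "set xs \<subseteq> E" "length xs + 1 = r" "ys \<in> tuples E (r + 1)" for xs ys
  proof (cases "distinct xs")
    case False
    then show ?thesis by (simp add: zero formal_sum_zero empty_in_nullset)
  next
    case xs: True
    show ?thesis
    proof (cases "distinct ys")
      case True
      show ?thesis
        by (rule orth_fundamental_circuit_iff[OF assms(1) True *(3), THEN iffD1])
          (rule orth[OF xs *(1,2) True *(3)])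
    next
      case False
      then obtain A y B C where ys: "ys = A @ [y] @ B @ [y] @ C"
        using not_distinct_decomp by blast
      define i where "i = length A"
      define j where "j = length (A @ y # B)"
      have len: "length ys = Suc r" using *(3) by (simp add: tuples_def)
      have oi: "omit i ys = A @ B @ y # C" and oj: "omit j ys = A @ y # B @ C"
        using omit_append[of A y "B @ y # C"] omit_append[of "A @ y # B" y C]
        by (simp_all add: ys i_def j_def)
      have yi: "ys ! i = y" and yj: "ys ! j = y" by (auto simp: ys i_def j_def nth_append)
      have tup: "A @ B @ y # C \<in> tuples E r" "A @ y # B @ C \<in> tuples E r"
        using *(3) by (auto simp: ys tuples_def)
      \<comment> \<open>Moving the remaining copy of \<open>y\<close> to the front compares the two surviving terms.\<close>
      have front: "\<phi> (A @ B @ y # C) = neg_one ^ (length A + length B) * \<phi> (y # A @ B @ C)"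
        "\<phi> (A @ y # B @ C) = neg_one ^ length A * \<phi> (y # A @ B @ C)"
        using alternating_move_head[OF alt, of "A @ B" y C] alternating_move_head[OF alt, of A y "B @ C"] tup
        by simp_all
      have j: "j = Suc (i + length B)" by (simp add: i_def j_def)
      have "neg_one ^ j * \<phi> (omit j ys) = neg_one * (neg_one ^ i * \<phi> (omit i ys))"
        unfolding oi oj front by (simp add: j i_def power_add ac_simps)
      then have op: "neg_one ^ j * \<phi> (omit j ys) * \<phi> (ys ! j # xs)
          = neg_one * (neg_one ^ i * \<phi> (omit i ys) * \<phi> (ys ! i # xs))"
        by (simp add: yi yj mult.assoc)
      have rest: "neg_one ^ k * \<phi> (omit k ys) * \<phi> (ys ! k # xs) = 0"
        if k: "k \<in> {0..r}" "k \<noteq> i" "k \<noteq> j" for k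
      proof -
        have ij: "i < length ys" "j < length ys" "i \<noteq> j" "k < length ys"
          using k len by (auto simp: i_def j_def ys)
        have "\<not> distinct (omit k ys)"
        proof
          assume d: "distinct (omit k ys)"
          \<comment> \<open>\<open>f m\<close> is the position at which entry \<open>m\<close> of \<open>ys\<close> ends up after position \<open>k\<close> is omitted.\<close>
          define f where "f m = (if m < k then m else m - 1)" for m
          have f: "omit k ys ! f m = ys ! m" "f m < length (omit k ys)"
            if "m < length ys" "m \<noteq> k" for m
            using that ij by (auto simp: f_def omit_def nth_append)
          have "f i = f j" using d f[of i] f[of j] ij k yi yj by (metis nth_eq_iff_index_eq)
          then show False using ij k by (auto simp: f_def split: if_splits)
        qed
        then show ?thesis by (simp add: zero)
      qed
      show ?thesis
        by (rule formal_sum_opposite_pair[where i=i and j=j])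
          (use op rest len in \<open>auto simp: i_def j_def ys\<close>)
    qed
  qed
  then show ?thesis using assms(2,3) alt unfolding GP_function_def by blast
qed

section \<open>The dual function\<close>

lemma GP_function_rank_le:
  assumes "GP_function E r \<phi>" "finite E"
  shows "r \<le> card E"
proof -
  obtain xs where "\<phi> xs \<noteq> 0" using GP_functionD(2)[OF assms(1)] by blast
  then have "xs \<in> tuples E r" "distinct xs" using GP_functionD(1,4)[OF assms(1)] by blast+
  then show ?thesis using assms(2) card_mono by (metis (mono_tags, lifting) distinct_card mem_Collect_eq tuples_def)
qed

text \<open>The definition of the dual function uses the sorted listing of the complement. Since \<open>\<phi>\<close> and the
  sign of the concatenation change by the same factor when this listing is permuted, every listing gives
  the same value. From here on the order of the ground set enters only through a sign.\<close>

lemma dual_function_eq: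
  assumes alt: "alternating E r \<phi>"
    and split: "distinct (xs @ ys)" "set (xs @ ys) = E" "length ys = r"
  shows "dual_function E r \<phi> xs = of_sign (sort_sign (xs @ ys)) * \<phi> ys"
proof -
  let ?c = "sorted_list_of_set (E - set xs)"
  have c: "E - set xs = set ys" using split by auto
  have "mset ?c = mset ys" using split by (simp add: c sorted_list_of_set_sort_remdups distinct_remdups_id)
  then obtain q where q: "q permutes {..<length ys}" "permute_list q ys = ?c"
    using mset_eq_permutation by metis
  have "card E = length (xs @ ys)" using split distinct_card[of "xs @ ys"] by simp
  then have xs: "xs \<in> tuples E (card E - r)" "distinct xs" using split by (auto simp: tuples_def)
  have "ys \<in> tuples E r" using split by (auto simp: tuples_def)
  then have "\<phi> ?c = of_sign (sign q) * \<phi> ys"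
    using alt q split(3) unfolding alternating_def by metis
  moreover have "sort_sign (xs @ ?c) = sign q * sort_sign (xs @ ys)"
    using sort_sign_permute_right[OF split(1) q(1)] q(2) by simp
  ultimately show ?thesis
    using xs of_sign_mult[OF sign_in_pm1 sort_sign_in_pm1, of q "xs @ ys", where 'a='b]
    by (simp add: dual_function_def Let_def ac_simps)
qed

lemma dual_function_eq_0:
  assumes "xs \<notin> tuples E (card E - r) \<or> \<not> distinct xs"
  shows "dual_function E r \<phi> xs = 0"
  using assms by (auto simp: dual_function_def)

lemma ex_complement_list:
  assumes "finite E" "distinct xs" "set xs \<subseteq> E"
  obtains ys where "distinct (xs @ ys)" "set (xs @ ys) = E" "length xs + length ys = card E"
proof -
  obtain ys where ys: "set ys = E - set xs" "distinct ys"
    using finite_distinct_list[of "E - set xs"] assms(1) by auto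
  then have "distinct (xs @ ys)" "set (xs @ ys) = E" using assms by auto
  moreover from this have "length xs + length ys = card E" using distinct_card[of "xs @ ys"] by simp
  ultimately show thesis using that by blast
qed

lemma alternating_dual_function:
  fixes \<phi> :: "'e::linorder list \<Rightarrow> 'a::idyll"
  assumes "finite E"
  shows "alternating E (card E - r) (dual_function E r \<phi>)"
  unfolding alternating_def
proof (intro conjI ballI allI impI)
  fix xs \<sigma> assume xs: "xs \<in> tuples E (card E - r)" and \<sigma>: "\<sigma> permutes {..<card E - r}"
  then have len: "length xs = card E - r" and sub: "set xs \<subseteq> E" by (auto simp: tuples_def)
  show "dual_function E r \<phi> (permute_list \<sigma> xs) = of_sign (sign \<sigma>) * dual_function E r \<phi> xs"
  proof (cases "distinct xs")
    case True
    let ?c = "sorted_list_of_set (E - set xs)"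
    have d: "distinct (xs @ ?c)" using True assms by auto
    have "sort_sign (permute_list \<sigma> xs @ ?c) = sign \<sigma> * sort_sign (xs @ ?c)"
      using sort_sign_permute_left[OF d, of \<sigma>] \<sigma> len by simp
    then show ?thesis
      using True xs \<sigma> len of_sign_mult[OF sign_in_pm1 sort_sign_in_pm1, of \<sigma> "xs @ ?c", where 'a='a]
      by (simp add: dual_function_def tuples_def Let_def mult.assoc)
  qed (use \<sigma> len in \<open>simp add: dual_function_def\<close>)
qed (simp add: dual_function_def)

text \<open>For \<open>zs = A @ e # B\<close>, the complement of \<open>A @ B\<close> is listed by \<open>e # us\<close>. The sign of
  \<open>A @ B @ e # us\<close> differs from that of \<open>zs @ us\<close> by moving \<open>e\<close> past \<open>B\<close>, and the sign
  \<open>(-1)\<^bsup>length A\<^esup>\<close> in the circuit supplies the move past \<open>A\<close>. Together they give an exponent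
  that is the same for all \<open>e\<close>. For \<open>e\<close> outside \<open>zs\<close> both sides are zero, because \<open>e\<close> occurs in
  \<open>us\<close> or lies outside \<open>E\<close>.\<close>

lemma fundamental_circuit_dual_function:
  assumes gp: "GP_function E r \<phi>"
    and split: "distinct (zs @ us)" "set (zs @ us) = E" "length us + 1 = r"
  shows "fundamental_circuit (dual_function E r \<phi>) zs e
    = neg_one ^ (length zs - 1) * of_sign (sort_sign (zs @ us)) * \<phi> (e # us)"
proof (cases "e \<in> set zs")
  case True
  then obtain A B where zs: "zs = A @ e # B" by (meson split_list)
  have "of_sign (sort_sign (A @ e # (B @ us))) = (neg_one ^ length A * of_sign (sort_sign (e # A @ B @ us)) :: 'b)"
    using split zs by (intro of_sign_sort_sign_move_head) auto
  moreover have "of_sign (sort_sign ((A @ B) @ e # us))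
      = (neg_one ^ length (A @ B) * of_sign (sort_sign (e # (A @ B) @ us)) :: 'b)"
    using split zs by (intro of_sign_sort_sign_move_head) auto
  moreover have "dual_function E r \<phi> (A @ B) = of_sign (sort_sign ((A @ B) @ e # us)) * \<phi> (e # us)"
    using split zs by (intro dual_function_eq GP_functionD[OF gp]) auto
  moreover have "fundamental_circuit (dual_function E r \<phi>) zs e
      = neg_one ^ length A * dual_function E r \<phi> (A @ B)"
    unfolding zs using split zs by (intro fundamental_circuit_append) auto
  ultimately show ?thesis
    using zs by (simp add: power_add ac_simps)
next
  case False
  then have "\<phi> (e # us) = 0"
    using split GP_functionD(1,4)[OF gp, of "e # us"] by (cases "e \<in> set us") (auto simp: tuples_def)
  then show ?thesis using False by (simp add: fundamental_circuit_outside)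
qed

text \<open>The mirror image of the previous identity, with the roles of \<open>\<phi>\<close> and its dual exchanged.\<close>

lemma dual_function_Cons:
  assumes alt: "alternating E r \<phi>"
    and split: "distinct (xs @ ws)" "set (xs @ ws) = E" "length ws = r + 1" and "e \<in> E"
  shows "dual_function E r \<phi> (e # xs)
    = neg_one ^ length xs * of_sign (sort_sign (xs @ ws)) * fundamental_circuit \<phi> ws e"
proof (cases "e \<in> set ws")
  case True
  then obtain A B where ws: "ws = A @ e # B" by (meson split_list)
  have "of_sign (sort_sign ((xs @ A) @ e # B))
      = (neg_one ^ length (xs @ A) * of_sign (sort_sign (e # (xs @ A) @ B)) :: 'b)"
    using split ws by (intro of_sign_sort_sign_move_head) auto
  moreover have "dual_function E r \<phi> (e # xs) = of_sign (sort_sign ((e # xs) @ (A @ B))) * \<phi> (A @ B)"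
    using split ws by (intro dual_function_eq[OF alt]) auto
  moreover have "fundamental_circuit \<phi> ws e = neg_one ^ length A * \<phi> (A @ B)"
    unfolding ws using split ws by (intro fundamental_circuit_append) auto
  ultimately show ?thesis
    using ws by (simp add: power_add ac_simps)
next
  case False
  then have "e \<in> set xs" using split(2) \<open>e \<in> E\<close> by auto
  then show ?thesis using False by (simp add: fundamental_circuit_outside dual_function_eq_0)
qed

text \<open>The two preceding identities turn the relation of \<open>\<phi>\<^sup>*\<close> at \<open>xs\<close> and \<open>ys\<close> into the relation of
  \<open>\<phi>\<close> at the complement \<open>us\<close> of \<open>ys\<close> and the complement \<open>ws\<close> of \<open>xs\<close>, with the two factors of
  each term interchanged.\<close>

lemma GP_function_dual:
  assumes gp: "GP_function E r \<phi>" and fin: "finite E"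
  shows "GP_function E (card E - r) (dual_function E r \<phi>)"
proof (rule GP_functionI[OF fin])
  have le: "r \<le> card E" using GP_function_rank_le[OF assms] .
  show "dual_function E r \<phi> xs = 0" if "xs \<notin> tuples E (card E - r)" for xs
    using that by (simp add: dual_function_eq_0)
  show "alternating E (card E - r) (dual_function E r \<phi>)"
    by (rule alternating_dual_function[OF fin])
  obtain xs where nz: "\<phi> xs \<noteq> 0" using GP_functionD(2)[OF gp] by blast
  then have xs: "xs \<in> tuples E r" "distinct xs" using GP_functionD(1,4)[OF gp] by blast+
  then obtain ys where "distinct (xs @ ys)" "set (xs @ ys) = E"
    using ex_complement_list[OF fin] by (metis (mono_tags, lifting) mem_Collect_eq tuples_def)
  then have "dual_function E r \<phi> ys = of_sign (sort_sign (ys @ xs)) * \<phi> xs"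
    using xs by (intro dual_function_eq GP_functionD[OF gp]) (auto simp: tuples_def)
  then show "\<exists>ys. dual_function E r \<phi> ys \<noteq> 0" using nz by (intro exI[of _ ys]) simp
  fix xs ys :: "'a list"
  assume xs: "distinct xs" "set xs \<subseteq> E" "length xs + 1 = card E - r"
    and ys: "distinct ys" "ys \<in> tuples E (card E - r + 1)"
  from ys have ys': "set ys \<subseteq> E" "length ys = card E - r + 1" by (auto simp: tuples_def)
  obtain us where us: "distinct (ys @ us)" "set (ys @ us) = E" "length ys + length us = card E"
    using ex_complement_list[OF fin ys(1) ys'(1)] .
  obtain ws where ws: "distinct (xs @ ws)" "set (xs @ ws) = E" "length xs + length ws = card E"
    using ex_complement_list[OF fin xs(1,2)] .
  have lu: "length us + 1 = r" and lw: "length ws = r + 1"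
    using us(3) ws(3) xs(3) ys'(2) le by linarith+
  have "orth E (fundamental_circuit \<phi> ws) (\<lambda>e. \<phi> (e # us))"
    using us ws lu lw by (intro GP_function_orth[OF gp fin]) (auto simp: tuples_def)
  then have "orth E (\<lambda>e. \<phi> (e # us)) (fundamental_circuit \<phi> ws)" by (simp add: orth_commute)
  from orth_scale[OF this] have "orth E
      (\<lambda>e. neg_one ^ (length ys - 1) * of_sign (sort_sign (ys @ us)) * \<phi> (e # us))
      (\<lambda>e. neg_one ^ length xs * of_sign (sort_sign (xs @ ws)) * fundamental_circuit \<phi> ws e)" .
  then show "orth E (fundamental_circuit (dual_function E r \<phi>) ys) (\<lambda>e. dual_function E r \<phi> (e # xs))"
    using fundamental_circuit_dual_function[OF gp us(1,2) lu]
      dual_function_Cons[OF GP_functionD(3)[OF gp] ws(1,2) lw]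
    by (subst orth_cong) auto
qed

text \<open>The sign is that of exchanging a block of length \<open>r\<close> with a block of length \<open>card E - r\<close>; it does
  not depend on \<open>xs\<close> and so disappears in the class of \<open>\<phi>\<close>.\<close>

lemma dual_function_dual_function:
  assumes gp: "GP_function E r \<phi>" and fin: "finite E"
  shows "dual_function E (card E - r) (dual_function E r \<phi>) xs
    = neg_one ^ (r * (card E - r)) * \<phi> xs"
proof (cases "xs \<in> tuples E r \<and> distinct xs")
  case True
  then have xs: "distinct xs" "set xs \<subseteq> E" "length xs = r" by (auto simp: tuples_def)
  obtain ys where ys: "distinct (xs @ ys)" "set (xs @ ys) = E" "length xs + length ys = card E"
    using ex_complement_list[OF fin xs(1,2)] .
  then have len: "length ys = card E - r" using xs by simp
  have "dual_function E (card E - r) (dual_function E r \<phi>) xs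
      = of_sign (sort_sign (xs @ ys)) * dual_function E r \<phi> ys"
    using ys len by (intro dual_function_eq alternating_dual_function fin) auto
  also have "dual_function E r \<phi> ys = of_sign (sort_sign (ys @ xs)) * \<phi> xs"
    using ys xs by (intro dual_function_eq GP_functionD[OF gp]) auto
  also have "sort_sign (xs @ ys) = (-1) ^ (length xs * length ys) * sort_sign (ys @ xs)"
    by (rule sort_sign_swap_blocks[OF ys(1)])
  finally show ?thesis
    unfolding of_sign_power_mult[OF sort_sign_in_pm1] using xs len by (simp add: ac_simps)
next
  case False
  moreover have "card E - (card E - r) = r" using GP_function_rank_le[OF assms] by simp
  ultimately show ?thesis using GP_functionD(1,4)[OF gp, of xs] by (auto simp: dual_function_def)
qed

section \<open>Dual matroids, vectors and covectors\<close>

lemma unit_class_self: "\<phi> \<in> unit_class \<phi>"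
  unfolding unit_class_def by (rule CollectI, rule exI[of _ 1]) simp

lemma unit_class_scale:
  assumes "c \<noteq> 0"
  shows "unit_class (\<lambda>xs. c * \<phi> xs) = unit_class \<phi>"
proof -
  obtain d where d: "c * d = 1" using ex_inverse[OF assms] by blast
  have "d \<noteq> 0" using d by auto
  have "\<exists>b. (\<lambda>xs. a * \<phi> xs) = (\<lambda>xs. b * (c * \<phi> xs)) \<and> b \<noteq> 0" if "a \<noteq> 0" for a
  proof (intro exI[of _ "a * d"] conjI ext)
    fix xs
    have "a * d * (c * \<phi> xs) = a * (c * d) * \<phi> xs" by (simp add: ac_simps)
    then show "a * \<phi> xs = a * d * (c * \<phi> xs)" by (simp add: d)
  qed (use that \<open>d \<noteq> 0\<close> in simp)
  moreover have "\<exists>b. (\<lambda>xs. a * (c * \<phi> xs)) = (\<lambda>xs. b * \<phi> xs) \<and> b \<noteq> 0" if "a \<noteq> 0" for a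
    using that assms by (intro exI[of _ "a * c"]) (simp add: mult.assoc)
  ultimately show ?thesis unfolding unit_class_def by (auto; metis)
qed

lemma dual_function_scale:
  "dual_function E r (\<lambda>xs. a * \<phi> xs) = (\<lambda>xs. a * dual_function E r \<phi> xs)"
  by (auto simp: dual_function_def Let_def mult.left_commute)

definition represents :: "('e list \<Rightarrow> 'a::idyll) \<Rightarrow> ('e, 'a) matroid \<Rightarrow> bool" where
  "represents \<phi> M \<longleftrightarrow> finite (ground M) \<and> GP_function (ground M) (rank M) \<phi> \<and> gp_class M = unit_class \<phi>"

lemma F_matroid_iff_represents: "F_matroid M \<longleftrightarrow> (\<exists>\<phi>. represents \<phi> M)"
  by (auto simp: F_matroid_def represents_def)

lemma ground_dual [simp]: "ground (dual M) = ground M"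
  and rank_dual [simp]: "rank (dual M) = card (ground M) - rank M"
  by (simp_all add: dual_def)

lemma represents_dual:
  assumes "represents \<phi> M"
  shows "represents (dual_function (ground M) (rank M) \<phi>) (dual M)"
proof -
  have "(\<Union>\<psi>\<in>unit_class \<phi>. unit_class (dual_function (ground M) (rank M) \<psi>))
      = unit_class (dual_function (ground M) (rank M) \<phi>)"
    using unit_class_self[of \<phi>]
    by (auto simp: unit_class_def[of \<phi>] dual_function_scale unit_class_scale)
  then show ?thesis using assms GP_function_dual unfolding represents_def
    by (auto simp: dual_def)
qed

lemma F_matroid_dual: "F_matroid M \<Longrightarrow> F_matroid (dual M)"
  using represents_dual unfolding F_matroid_iff_represents by blast

lemma dual_dual:
  assumes "F_matroid M"
  shows "dual (dual M) = M"
proof -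
  obtain \<phi> where \<phi>: "represents \<phi> M" using assms unfolding F_matroid_iff_represents by blast
  then have gp: "GP_function (ground M) (rank M) \<phi>" and fin: "finite (ground M)"
    by (auto simp: represents_def)
  have "represents (dual_function (ground M) (card (ground M) - rank M)
      (dual_function (ground M) (rank M) \<phi>)) (dual (dual M))"
    using represents_dual[OF represents_dual[OF \<phi>]] by simp
  then have "gp_class (dual (dual M)) = unit_class (\<lambda>xs. neg_one ^ (rank M * (card (ground M) - rank M)) * \<phi> xs)"
    unfolding represents_def dual_function_dual_function[OF gp fin, abs_def] by blast
  then have "gp_class (dual (dual M)) = gp_class M"
    using \<phi> by (simp add: unit_class_scale represents_def)
  moreover have "rank (dual (dual M)) = rank M" using GP_function_rank_le[OF gp fin] by simp
  ultimately show ?thesis by (intro matroid.equality) auto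
qed

lemma cocircuits_dual: "F_matroid M \<Longrightarrow> cocircuits (dual M) = circuits M"
  by (simp add: cocircuits_def dual_dual)

lemma vectors_dual: "F_matroid M \<Longrightarrow> vectors (dual M) = covectors M"
  by (simp add: vectors_def covectors_def cocircuits_dual)

lemma fundamental_circuit_scale:
  "fundamental_circuit (\<lambda>xs. a * \<phi> xs) ys e = a * fundamental_circuit \<phi> ys e"
  by (simp add: fundamental_circuit_def Let_def mult.left_commute)

text \<open>The right-hand side ranges over all distinct tuples; at those that do not give a circuit, the
  fundamental circuit is identically zero, hence orthogonal to everything.\<close>

lemma orth_circuits_iff:
  assumes \<phi>: "represents \<phi> M"
  shows "(\<forall>Y\<in>circuits M. orth (ground M) X Y) \<longleftrightarrow>
    (\<forall>ys. ys \<in> tuples (ground M) (rank M + 1) \<and> distinct ys \<longrightarrow>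
      orth (ground M) X (fundamental_circuit \<phi> ys))" (is "?L \<longleftrightarrow> ?R")
proof
  assume L: ?L
  show ?R
  proof (intro allI impI, elim conjE)
    fix ys assume ys: "ys \<in> tuples (ground M) (rank M + 1)" "distinct ys"
    show "orth (ground M) X (fundamental_circuit \<phi> ys)"
    proof (cases "\<exists>k\<le>rank M. \<phi> (omit k ys) \<noteq> 0")
      case True
      have "\<phi> \<in> gp_class M" using \<phi> unit_class_self by (auto simp: represents_def)
      then have "(\<lambda>e. 1 * fundamental_circuit \<phi> ys e) \<in> circuits M"
        unfolding circuits_def using ys True
        by (intro CollectI exI[of _ 1] exI[of _ \<phi>] exI[of _ ys]) auto
      then show ?thesis using L by auto
    next
      case False
      have "fundamental_circuit \<phi> ys e = 0" for e
      proof (cases "e \<in> set ys")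
        case True
        then obtain k where k: "k < length ys" "ys ! k = e" by (auto simp: in_set_conv_nth)
        then have "k \<le> rank M" using ys(1) by (auto simp: tuples_def)
        then show ?thesis using fundamental_circuit_nth[OF ys(2) k(1), of \<phi>] k False by simp
      qed (simp add: fundamental_circuit_outside)
      then show ?thesis by (intro orth_zero_right)
    qed
  qed
next
  assume R: ?R
  show ?L
  proof
    fix Y assume "Y \<in> circuits M"
    then obtain a \<psi> ys where Y: "Y = (\<lambda>e. a * fundamental_circuit \<psi> ys e)" "\<psi> \<in> gp_class M"
      "ys \<in> tuples (ground M) (rank M + 1)" "distinct ys" unfolding circuits_def by blast
    obtain b where "\<psi> = (\<lambda>xs. b * \<phi> xs)"
      using Y(2) \<phi> by (auto simp: represents_def unit_class_def)
    then have "Y = (\<lambda>e. (a * b) * fundamental_circuit \<phi> ys e)"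
      by (simp add: Y(1) fundamental_circuit_scale mult.assoc)
    moreover have "orth (ground M) (\<lambda>e. 1 * X e) (\<lambda>e. (a * b) * fundamental_circuit \<phi> ys e)"
      using R Y(3,4) by (intro orth_scale) blast
    ultimately show "orth (ground M) X Y" by simp
  qed
qed

lemma covectors_iff:
  assumes "represents \<phi> M"
  shows "X \<in> covectors M \<longleftrightarrow> X \<in> vecs_on (ground M) \<and>
    (\<forall>ys. ys \<in> tuples (ground M) (rank M + 1) \<and> distinct ys \<longrightarrow>
      orth (ground M) X (fundamental_circuit \<phi> ys))"
  unfolding covectors_def using orth_circuits_iff[OF assms, of X] by blast

text \<open>Every cocircuit is, up to a unit, a function sending \<open>e\<close> to \<open>\<phi> (e # us)\<close>. For rank \<open>0\<close> there is no
  such \<open>us\<close>, and there are no cocircuits either. In contrast to the definition, this description does not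
  refer to the order of the ground set.\<close>

lemma vectors_iff:
  assumes \<phi>: "represents \<phi> M"
  shows "X \<in> vectors M \<longleftrightarrow> X \<in> vecs_on (ground M) \<and>
    (\<forall>us. set us \<subseteq> ground M \<and> length us + 1 = rank M \<longrightarrow>
      orth (ground M) X (\<lambda>e. \<phi> (e # us)))"
proof -
  let ?E = "ground M" and ?r = "rank M"
  let ?d = "dual_function ?E ?r \<phi>"
  have gp: "GP_function ?E ?r \<phi>" and fin: "finite ?E" using \<phi> by (auto simp: represents_def)
  have le: "?r \<le> card ?E" by (rule GP_function_rank_le[OF gp fin])
  \<comment> \<open>The sign relating a fundamental circuit of the dual at \<open>zs\<close> to the values of \<open>\<phi>\<close>.\<close>
  define c :: "'a list \<Rightarrow> 'a list \<Rightarrow> 'b" where "c zs us = neg_one ^ (length zs - 1) * of_sign (sort_sign (zs @ us))" for zs us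
  have c: "c zs us * c zs us = 1" for zs us
    by (simp add: c_def ac_simps)
  have fc: "fundamental_circuit ?d zs = (\<lambda>e. c zs us * \<phi> (e # us))"
    if "distinct (zs @ us)" "set (zs @ us) = ?E" "length us + 1 = ?r" for zs us
    unfolding c_def using fundamental_circuit_dual_function[OF gp that] by (rule ext)
  have "(\<forall>zs. zs \<in> tuples ?E (card ?E - ?r + 1) \<and> distinct zs \<longrightarrow> orth ?E X (fundamental_circuit ?d zs))
    \<longleftrightarrow> (\<forall>us. set us \<subseteq> ?E \<and> length us + 1 = ?r \<longrightarrow> orth ?E X (\<lambda>e. \<phi> (e # us)))" (is "?L \<longleftrightarrow> ?R")
  proof
    assume L: ?L
    show ?R
    proof (intro allI impI, elim conjE)
      fix us assume us: "set us \<subseteq> ?E" "length us + 1 = ?r"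
      show "orth ?E X (\<lambda>e. \<phi> (e # us))"
      proof (cases "distinct us")
        case True
        obtain zs where zs: "distinct (us @ zs)" "set (us @ zs) = ?E" "length us + length zs = card ?E"
          using ex_complement_list[OF fin True us(1)] .
        then have zs': "distinct (zs @ us)" "set (zs @ us) = ?E" by auto
        have "zs \<in> tuples ?E (card ?E - ?r + 1)" using zs us le by (auto simp: tuples_def)
        then have "orth ?E X (\<lambda>e. c zs us * \<phi> (e # us))"
          using L zs' fc[OF zs' us(2)] by (metis distinct_append)
        from orth_scale[OF this, of 1 "c zs us"] show ?thesis
          by (simp add: c flip: mult.assoc)
      next
        case False
        then show ?thesis using GP_functionD(4)[OF gp] by (intro orth_zero_right) auto
      qed
    qed
  next
    assume R: ?R
    show ?L
    proof (intro allI impI, elim conjE)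
      fix zs assume zs: "zs \<in> tuples ?E (card ?E - ?r + 1)" "distinct zs"
      then have sub: "set zs \<subseteq> ?E" and len: "length zs = card ?E - ?r + 1" by (auto simp: tuples_def)
      obtain us where us: "distinct (zs @ us)" "set (zs @ us) = ?E" "length zs + length us = card ?E"
        using ex_complement_list[OF fin zs(2) sub] .
      then have r: "length us + 1 = ?r" using len le by linarith
      have "orth ?E X (\<lambda>e. \<phi> (e # us))" using R us r by auto
      from orth_scale[OF this, of 1 "c zs us"] show "orth ?E X (fundamental_circuit ?d zs)"
        by (simp add: fc[OF us(1,2) r])
    qed
  qed
  then show ?thesis
    unfolding vectors_def cocircuits_def
    using orth_circuits_iff[OF represents_dual[OF \<phi>], of X] by auto
qed

text \<open>In the description of vectors just given, this is literally the Grassmann--Pluecker relations.\<close>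

lemma circuits_subset_vectors:
  assumes "F_matroid M"
  shows "circuits M \<subseteq> vectors M"
proof -
  obtain \<phi> where \<phi>: "represents \<phi> M" using assms unfolding F_matroid_iff_represents by blast
  then have gp: "GP_function (ground M) (rank M) \<phi>" and fin: "finite (ground M)"
    by (auto simp: represents_def)
  have orth: "\<forall>X\<in>circuits M. orth (ground M) (\<lambda>e. \<phi> (e # us)) X"
    if "set us \<subseteq> ground M" "length us + 1 = rank M" for us
    unfolding orth_circuits_iff[OF \<phi>]
    using GP_function_orth[OF gp fin _ _ that] by (auto simp: orth_commute)
  have "X \<in> vecs_on (ground M)" if X: "X \<in> circuits M" for X
    unfolding vecs_on_def
  proof (intro CollectI allI impI)
    fix e assume e: "e \<notin> ground M"
    obtain a \<psi> ys where "X = (\<lambda>e. a * fundamental_circuit \<psi> ys e)" "\<psi> \<in> gp_class M"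
      "ys \<in> tuples (ground M) (rank M + 1)" "distinct ys"
      using X unfolding circuits_def by blast
    moreover from this e have "e \<notin> set ys" by (auto simp: tuples_def)
    ultimately show "X e = 0" by (simp add: fundamental_circuit_outside)
  qed
  then show ?thesis unfolding vectors_iff[OF \<phi>] subset_iff
    using orth by (auto simp: orth_commute)
qed

section \<open>Orthogonality of vectors and covectors\<close>

lemma orth_image:
  assumes "inj_on f E"
  shows "orth (f ` E) X Y \<longleftrightarrow> orth E (\<lambda>e. X (f e)) (\<lambda>e. Y (f e))"
  by (simp add: orth_def formal_sum_image[OF assms])

definition relabelled_function ::
    "('e \<Rightarrow> 'd) \<Rightarrow> 'e set \<Rightarrow> nat \<Rightarrow> ('e list \<Rightarrow> 'a::idyll) \<Rightarrow> 'd list \<Rightarrow> 'a" where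
  "relabelled_function f E r \<phi> xs = (if xs \<in> tuples (f ` E) r then \<phi> (map (inv_into E f) xs) else 0)"

text \<open>Tuples in the image of \<open>f\<close> are handled by lifting them to tuples in \<open>E\<close>, so that the transported
  function is only ever evaluated on lists of the form \<open>map f xs\<close>.\<close>

lemma tuples_image_cases:
  assumes "xs \<in> tuples (f ` E) r"
  obtains ys where "ys \<in> tuples E r" "xs = map f ys"
proof
  show "map (inv_into E f) xs \<in> tuples E r"
    using assms by (auto simp: tuples_def inv_into_into)
  show "xs = map f (map (inv_into E f) xs)"
    using assms by (auto simp: tuples_def f_inv_into_f subset_iff intro!: map_idI[symmetric])
qed

lemma relabelled_function_map:
  assumes "inj_on f E" "xs \<in> tuples E r"
  shows "relabelled_function f E r \<phi> (map f xs) = \<phi> xs"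
proof -
  have "map f xs \<in> tuples (f ` E) r" using assms(2) by (auto simp: tuples_def)
  moreover have "map (inv_into E f) (map f xs) = xs"
    using assms by (auto simp: tuples_def inv_into_f_f subset_iff intro!: map_idI)
  ultimately show ?thesis by (simp add: relabelled_function_def)
qed

lemma distinct_map_tuple:
  assumes "inj_on f E" "xs \<in> tuples E r"
  shows "distinct (map f xs) = distinct xs"
  using assms by (auto simp: distinct_map tuples_def intro: inj_on_subset)

lemma fundamental_circuit_relabelled:
  assumes inj: "inj_on f E" and ys: "ys \<in> tuples E (r + 1)" "distinct ys" and "e \<in> E"
  shows "fundamental_circuit (relabelled_function f E r \<phi>) (map f ys) (f e) = fundamental_circuit \<phi> ys e"
proof (cases "e \<in> set ys")
  case True
  then obtain k where k: "k < length ys" "ys ! k = e" by (auto simp: in_set_conv_nth)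
  have "omit k ys \<in> tuples E r"
    using ys k set_omit_subset[of k ys] length_omit[OF k(1)] by (auto simp: tuples_def)
  then have "relabelled_function f E r \<phi> (omit k (map f ys)) = \<phi> (omit k ys)"
    using relabelled_function_map[OF inj] by (simp flip: map_omit)
  moreover have "distinct (map f ys)" using distinct_map_tuple[OF inj ys(1)] ys(2) by simp
  ultimately show ?thesis
    using fundamental_circuit_nth[of "map f ys" k "relabelled_function f E r \<phi>"]
      fundamental_circuit_nth[OF ys(2) k(1), of \<phi>] k by simp
next
  case False
  then have "f e \<notin> set (map f ys)"
    using inj \<open>e \<in> E\<close> ys(1) by (auto simp: tuples_def inj_on_def)
  then show ?thesis using False by (simp add: fundamental_circuit_outside)
qed

lemma GP_function_relabelled:
  assumes gp: "GP_function E r \<phi>" and fin: "finite E" and inj: "inj_on f E"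
  shows "GP_function (f ` E) r (relabelled_function f E r \<phi>)" (is "GP_function _ _ ?\<phi>")
proof (rule GP_functionI)
  note map = relabelled_function_map[OF inj, of _ r \<phi>]
  show "finite (f ` E)" using fin by simp
  show "?\<phi> xs = 0" if "xs \<notin> tuples (f ` E) r" for xs
    using that by (simp add: relabelled_function_def)
  obtain xs where "\<phi> xs \<noteq> 0" using GP_functionD(2)[OF gp] by blast
  moreover from this have "xs \<in> tuples E r" using GP_functionD(1)[OF gp] by blast
  ultimately show "\<exists>xs. ?\<phi> xs \<noteq> 0" using map by metis
  show "alternating (f ` E) r ?\<phi>" unfolding alternating_def
  proof (intro conjI ballI allI impI)
    fix xs' \<sigma> assume xs': "xs' \<in> tuples (f ` E) r" and \<sigma>: "\<sigma> permutes {..<r}"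
    obtain xs where xs: "xs \<in> tuples E r" "xs' = map f xs" using tuples_image_cases[OF xs'] .
    then have \<sigma>': "\<sigma> permutes {..<length xs}" using \<sigma> by (simp add: tuples_def)
    then have "permute_list \<sigma> xs \<in> tuples E r" using xs by (simp add: tuples_def)
    then have "?\<phi> (permute_list \<sigma> xs') = \<phi> (permute_list \<sigma> xs)"
      using map by (simp add: xs(2) permute_list_map[OF \<sigma>'])
    also have "\<dots> = of_sign (sign \<sigma>) * ?\<phi> xs'"
      using GP_functionD(3)[OF gp] xs \<sigma> map unfolding alternating_def by simp
    finally show "?\<phi> (permute_list \<sigma> xs') = of_sign (sign \<sigma>) * ?\<phi> xs'" .
  next
    fix xs' assume xs': "xs' \<in> tuples (f ` E) r" "\<not> distinct xs'"
    obtain xs where xs: "xs \<in> tuples E r" "xs' = map f xs" using tuples_image_cases[OF xs'(1)] .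
    then show "?\<phi> xs' = 0"
      using xs'(2) map distinct_map_tuple[OF inj] GP_functionD(4)[OF gp] by simp
  qed
  fix xs' ys' assume xs': "set xs' \<subseteq> f ` E" "length xs' + 1 = r"
    and ys': "distinct ys'" "ys' \<in> tuples (f ` E) (r + 1)"
  have "xs' \<in> tuples (f ` E) (length xs')" using xs' by (simp add: tuples_def)
  then obtain xs where xs: "xs \<in> tuples E (length xs')" "xs' = map f xs"
    using tuples_image_cases by metis
  obtain ys where ys: "ys \<in> tuples E (r + 1)" "ys' = map f ys" using tuples_image_cases[OF ys'(2)] .
  have d: "distinct ys" using ys'(1) distinct_map_tuple[OF inj ys(1)] ys(2) by simp
  have "?\<phi> (f e # xs') = \<phi> (e # xs)" if "e \<in> E" for e
    using map[of "e # xs"] that xs xs'(2) by (auto simp: tuples_def)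
  moreover have "orth E (fundamental_circuit \<phi> ys) (\<lambda>e. \<phi> (e # xs))"
    using xs xs'(2) by (intro GP_function_orth[OF gp fin d ys(1)]) (auto simp: tuples_def)
  ultimately show "orth (f ` E) (fundamental_circuit ?\<phi> ys') (\<lambda>e. ?\<phi> (e # xs'))"
    unfolding orth_image[OF inj] ys(2)
    using fundamental_circuit_relabelled[OF inj ys(1) d] by (subst orth_cong) auto
qed

text \<open>An injection of the ground set into the natural numbers carries the matroid, the vector \<open>X\<close> and
  the covector \<open>Y\<close> to the setting in which perfectness is stated. Any injection will do, because vectors
  and covectors are both described without reference to an order.\<close>

lemma orth_vectors_covectors:
  fixes M :: "('e::linorder, 'a::idyll) matroid"
  assumes perfect: "perfect_idyll TYPE('a)" and M: "F_matroid M"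
    and X: "X \<in> vectors M" and Y: "Y \<in> covectors M"
  shows "orth (ground M) X Y"
proof -
  let ?E = "ground M" and ?r = "rank M"
  obtain \<phi> where \<phi>: "represents \<phi> M" using M unfolding F_matroid_iff_represents by blast
  then have gp: "GP_function ?E ?r \<phi>" and fin: "finite ?E" by (auto simp: represents_def)
  obtain f :: "'e \<Rightarrow> nat" where inj: "inj_on f ?E"
    using finite_imp_inj_to_nat_seg[OF fin] by blast
  let ?\<psi> = "relabelled_function f ?E ?r \<phi>"
  define M' where "M' = \<lparr>ground = f ` ?E, rank = ?r, gp_class = unit_class ?\<psi>\<rparr>"
  have \<psi>: "represents ?\<psi> M'"
    using fin GP_function_relabelled[OF gp fin inj] by (simp add: represents_def M'_def)
  define push :: "('e \<Rightarrow> 'a) \<Rightarrow> nat \<Rightarrow> 'a"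
    where "push Z n = (if n \<in> f ` ?E then Z (inv_into ?E f n) else 0)" for Z n
  have push: "push Z (f e) = Z e" if "e \<in> ?E" for Z e
    using that inj by (simp add: push_def)
  have on: "push Z \<in> vecs_on (f ` ?E)" for Z by (simp add: push_def vecs_on_def)
  have "push X \<in> vectors M'" unfolding vectors_iff[OF \<psi>]
  proof (intro conjI allI impI)
    show "push X \<in> vecs_on (ground M')" using on by (simp add: M'_def)
    fix us' assume us': "set us' \<subseteq> ground M' \<and> length us' + 1 = rank M'"
    then have "us' \<in> tuples (f ` ?E) (length us')" by (simp add: tuples_def M'_def)
    then obtain us where us: "us \<in> tuples ?E (length us')" "us' = map f us"
      using tuples_image_cases by metis
    have "?\<psi> (f e # us') = \<phi> (e # us)" if "e \<in> ?E" for e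
      using relabelled_function_map[OF inj, of "e # us" ?r \<phi>] that us us'
      by (auto simp: tuples_def M'_def)
    moreover have "orth ?E X (\<lambda>e. \<phi> (e # us))"
      using X us us' unfolding vectors_iff[OF \<phi>] by (auto simp: tuples_def M'_def)
    ultimately have "orth (f ` ?E) (push X) (\<lambda>e. ?\<psi> (e # us'))"
      unfolding orth_image[OF inj] using push by (subst orth_cong) auto
    then show "orth (ground M') (push X) (\<lambda>e. ?\<psi> (e # us'))" by (simp add: M'_def)
  qed
  moreover have "push Y \<in> covectors M'" unfolding covectors_iff[OF \<psi>]
  proof (intro conjI allI impI)
    show "push Y \<in> vecs_on (ground M')" using on by (simp add: M'_def)
    fix ys' assume "ys' \<in> tuples (ground M') (rank M' + 1) \<and> distinct ys'"
    then have ys': "ys' \<in> tuples (f ` ?E) (?r + 1)" "distinct ys'" by (simp_all add: M'_def)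
    obtain ys where ys: "ys \<in> tuples ?E (?r + 1)" "ys' = map f ys" using tuples_image_cases[OF ys'(1)] .
    have d: "distinct ys" using ys'(2) distinct_map_tuple[OF inj ys(1)] ys(2) by simp
    have "orth ?E Y (fundamental_circuit \<phi> ys)"
      using Y ys(1) d unfolding covectors_iff[OF \<phi>] by blast
    then have "orth (f ` ?E) (push Y) (fundamental_circuit ?\<psi> ys')"
      unfolding orth_image[OF inj] ys(2)
      using push fundamental_circuit_relabelled[OF inj ys(1) d] by (subst orth_cong) auto
    then show "orth (ground M') (push Y) (fundamental_circuit ?\<psi> ys')" by (simp add: M'_def)
  qed
  moreover have "F_matroid M'" using \<psi> unfolding F_matroid_iff_represents by blast
  ultimately have "orth (f ` ?E) (push X) (push Y)"
    using perfect unfolding perfect_idyll_def by (auto simp: M'_def)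
  then have "orth ?E (\<lambda>e. push X (f e)) (\<lambda>e. push Y (f e))" unfolding orth_image[OF inj] .
  then show ?thesis using push by (subst orth_cong) auto
qed

section \<open>Submonomial matrices\<close>

text \<open>The value \<open>f j\<close> may be zero: then no summand is nonzero, and the sum is zero as well.\<close>

lemma single_sum_eqI:
  assumes "j \<in> I" "\<And>k. k \<in> I \<Longrightarrow> f k \<noteq> 0 \<Longrightarrow> k = j"
  shows "single_sum f I = f j"
proof (cases "\<exists>!k. k \<in> I \<and> f k \<noteq> 0")
  case True
  have "(THE k. k \<in> I \<and> f k \<noteq> 0) = j"
    using theI'[OF True] by (elim conjE) (rule assms(2))
  then show ?thesis unfolding single_sum_def using True by simp
next
  case False
  have "f j = 0"
  proof (rule ccontr)
    assume "f j \<noteq> 0"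
    with assms(1) have "j \<in> I \<and> f j \<noteq> 0" by (rule conjI)
    then have "\<exists>!k. k \<in> I \<and> f k \<noteq> 0" by (rule ex1I) (elim conjE, rule assms(2))
    with False show False by (rule notE)
  qed
  then show ?thesis unfolding single_sum_def using False by (simp only: if_False)
qed

lemma single_sum_nonzeroE:
  assumes "single_sum f I \<noteq> 0"
  obtains j where "j \<in> I" "f j \<noteq> 0"
proof -
  have "\<exists>!j. j \<in> I \<and> f j \<noteq> 0" using assms unfolding single_sum_def by (rule contrapos_np) simp
  then show thesis using that by blast
qed

lemma submonomialD:
  assumes "submonomial T S \<Phi>" "\<Phi> i j \<noteq> 0"
  shows "i \<in> T" "j \<in> S" "\<Phi> i k \<noteq> 0 \<Longrightarrow> k = j" "\<Phi> l j \<noteq> 0 \<Longrightarrow> l = i"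
proof -
  show *: "i \<in> T" "j \<in> S" using assms unfolding submonomial_def by blast+
  then show "\<Phi> i k \<noteq> 0 \<Longrightarrow> k = j" "\<Phi> l j \<noteq> 0 \<Longrightarrow> l = i"
    using assms unfolding submonomial_def Uniq_def by metis+
qed

lemma submonomial_transpose: "submonomial T S \<Phi> \<Longrightarrow> submonomial S T (mat_transpose \<Phi>)"
  by (auto simp: submonomial_def mat_transpose_def)

lemma mat_apply_entry:
  fixes \<Phi> :: "'t \<Rightarrow> 's \<Rightarrow> 'a::idyll"
  assumes "submonomial T S \<Phi>" "\<Phi> i j \<noteq> 0"
  shows "mat_apply S \<Phi> X i = \<Phi> i j * X j"
  unfolding mat_apply_def
proof (rule single_sum_eqI)
  show "j \<in> S" by (rule submonomialD(2)[OF assms])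
  show "k = j" if "\<Phi> i k * X k \<noteq> 0" for k
    using that by (intro submonomialD(3)[OF assms]) simp
qed

lemma mat_apply_nonzeroE:
  fixes \<Phi> :: "'t \<Rightarrow> 's \<Rightarrow> 'a::idyll"
  assumes "mat_apply S \<Phi> X i \<noteq> 0"
  obtains j where "\<Phi> i j \<noteq> 0" "X j \<noteq> 0"
proof -
  obtain j where "\<Phi> i j * X j \<noteq> 0"
    using assms unfolding mat_apply_def by (rule single_sum_nonzeroE)
  then show thesis by (intro that[of j]) simp_all
qed

lemma mat_apply_vecs_on:
  fixes \<Phi> :: "'t \<Rightarrow> 's \<Rightarrow> 'a::idyll"
  assumes "submonomial T S \<Phi>"
  shows "mat_apply S \<Phi> X \<in> vecs_on T"
  unfolding vecs_on_def
proof (intro CollectI allI impI, rule ccontr)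
  fix i assume "i \<notin> T" "mat_apply S \<Phi> X i \<noteq> 0"
  then obtain j where "\<Phi> i j \<noteq> 0" by (elim mat_apply_nonzeroE)
  then show False using submonomialD(1)[OF assms] \<open>i \<notin> T\<close> by blast
qed

text \<open>The set \<open>P\<close> of positions of nonzero entries projects injectively to rows and to columns. Rows and
  columns that it misses contribute zero, and at a position \<open>(i, j)\<close> of \<open>P\<close> both sides have the term
  \<open>\<Phi> i j * X j * Y i\<close>.\<close>

lemma orth_mat_apply:
  fixes \<Phi> :: "'t \<Rightarrow> 's \<Rightarrow> 'a::idyll"
  assumes \<Phi>: "submonomial T S \<Phi>" and fin: "finite T" "finite S"
  shows "orth T (mat_apply S \<Phi> X) Y \<longleftrightarrow> orth S X (mat_apply T (mat_transpose \<Phi>) Y)"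
proof -
  define P where "P = {(i, j). \<Phi> i j \<noteq> 0}"
  have sub: "fst ` P \<subseteq> T" "snd ` P \<subseteq> S" using submonomialD(1,2)[OF \<Phi>] by (auto simp: P_def)
  have inj: "inj_on fst P" "inj_on snd P"
    by (auto simp: P_def inj_on_def dest: submonomialD(3,4)[OF \<Phi>])
  let ?Z = "mat_apply T (mat_transpose \<Phi>) Y"
  have Z: "?Z j = \<Phi> i j * Y i" if "\<Phi> i j \<noteq> 0" for i j
    using mat_apply_entry[OF submonomial_transpose[OF \<Phi>], of j i Y] that by (simp add: mat_transpose_def)
  have row: "mat_apply S \<Phi> X i = 0" if "i \<notin> fst ` P" for i
  proof (rule ccontr)
    assume "mat_apply S \<Phi> X i \<noteq> 0"
    then obtain j where "\<Phi> i j \<noteq> 0" by (rule mat_apply_nonzeroE)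
    then have "(i, j) \<in> P" by (simp add: P_def)
    with that show False by (metis fst_conv image_eqI)
  qed
  have column: "?Z j = 0" if "j \<notin> snd ` P" for j
  proof (rule ccontr)
    assume "?Z j \<noteq> 0"
    then obtain i where "mat_transpose \<Phi> j i \<noteq> 0" by (rule mat_apply_nonzeroE)
    then have "(i, j) \<in> P" by (simp add: P_def mat_transpose_def)
    with that show False by (metis snd_conv image_eqI)
  qed
  have "formal_sum (\<lambda>i. mat_apply S \<Phi> X i * Y i) T = formal_sum (\<lambda>i. mat_apply S \<Phi> X i * Y i) (fst ` P)"
    by (rule formal_sum_superset[OF fin(1) sub(1)]) (simp add: row)
  also have "\<dots> = formal_sum (\<lambda>(i, j). \<Phi> i j * X j * Y i) P"
    unfolding formal_sum_image[OF inj(1)]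
    by (rule formal_sum_cong) (auto simp: P_def mat_apply_entry[OF \<Phi>])
  also have "\<dots> = formal_sum (\<lambda>j. X j * ?Z j) (snd ` P)"
    unfolding formal_sum_image[OF inj(2)]
    by (rule formal_sum_cong) (auto simp: P_def Z ac_simps)
  also have "\<dots> = formal_sum (\<lambda>j. X j * ?Z j) S"
    by (rule formal_sum_superset[OF fin(2) sub(2), symmetric]) (simp add: column)
  finally show ?thesis by (simp add: orth_def)
qed

text \<open>A circuit \<open>C\<close> of \<open>N\<close> is a vector, so \<open>\<Phi> C\<close> is a vector of \<open>M\<close> and, by perfectness, orthogonal
  to each covector \<open>Y\<close> of \<open>M\<close>. By adjointness \<open>C\<close> is orthogonal to \<open>\<Phi>\<^sup>t Y\<close>.\<close>

lemma F_morphism_transpose: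
  fixes N :: "('s::linorder, 'a::idyll) matroid" and M :: "('t::linorder, 'a) matroid"
  assumes perfect: "perfect_idyll TYPE('a)" and \<Phi>: "F_morphism N M \<Phi>"
  shows "F_morphism (dual M) (dual N) (mat_transpose \<Phi>)"
proof -
  have N: "F_matroid N" and M: "F_matroid M" and sub: "submonomial (ground M) (ground N) \<Phi>"
    and maps: "mat_apply (ground N) \<Phi> ` vectors N \<subseteq> vectors M"
    using \<Phi> by (auto simp: F_morphism_def)
  have fin: "finite (ground M)" "finite (ground N)" using M N by (auto simp: F_matroid_def)
  have "mat_apply (ground M) (mat_transpose \<Phi>) Y \<in> covectors N" if Y: "Y \<in> covectors M" for Y
    unfolding covectors_def
  proof (intro CollectI conjI ballI)
    show "mat_apply (ground M) (mat_transpose \<Phi>) Y \<in> vecs_on (ground N)"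
      by (rule mat_apply_vecs_on[OF submonomial_transpose[OF sub]])
    fix C assume "C \<in> circuits N"
    then have "mat_apply (ground N) \<Phi> C \<in> vectors M"
      using circuits_subset_vectors[OF N] maps by blast
    then have "orth (ground M) (mat_apply (ground N) \<Phi> C) Y"
      by (rule orth_vectors_covectors[OF perfect M _ Y])
    then show "orth (ground N) (mat_apply (ground M) (mat_transpose \<Phi>) Y) C"
      using orth_mat_apply[OF sub fin] by (simp add: orth_commute)
  qed
  then show ?thesis
    using F_matroid_dual[OF M] F_matroid_dual[OF N] submonomial_transpose[OF sub]
    by (auto simp: F_morphism_def vectors_dual M N)
qed

section \<open>The category of matroids\<close>

text \<open>Reading a product column by column reduces associativity and the left unit law to statements about
  the action on vectors.\<close>

lemma mat_mult_column: "mat_mult T \<Psi> \<Phi> i k = mat_apply T \<Psi> (\<lambda>j. \<Phi> j k) i"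
  by (simp add: mat_mult_def mat_apply_def)

lemma mat_mult_nonzeroE:
  fixes \<Phi> :: "'t \<Rightarrow> 's \<Rightarrow> 'a::idyll"
  assumes "mat_mult T \<Psi> \<Phi> i k \<noteq> 0"
  obtains j where "\<Psi> i j \<noteq> 0" "\<Phi> j k \<noteq> 0"
  using assms unfolding mat_mult_column by (rule mat_apply_nonzeroE)

lemma submonomial_mat_mult:
  fixes \<Phi> :: "'t \<Rightarrow> 's \<Rightarrow> 'a::idyll"
  assumes \<Psi>: "submonomial U T \<Psi>" and \<Phi>: "submonomial T S \<Phi>"
  shows "submonomial U S (mat_mult T \<Psi> \<Phi>)"
  unfolding submonomial_def Uniq_def
proof (intro conjI allI impI ballI)
  fix i j assume *: "(i, j) \<notin> U \<times> S"
  show "mat_mult T \<Psi> \<Phi> i j = 0"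
  proof (rule ccontr)
    assume "mat_mult T \<Psi> \<Phi> i j \<noteq> 0"
    then obtain l where "\<Psi> i l \<noteq> 0" "\<Phi> l j \<noteq> 0" by (rule mat_mult_nonzeroE)
    then show False using * submonomialD(1)[OF \<Psi>, of i l] submonomialD(2)[OF \<Phi>, of l j] by simp
  qed
next
  fix i j k assume nz: "mat_mult T \<Psi> \<Phi> i j \<noteq> 0" "mat_mult T \<Psi> \<Phi> i k \<noteq> 0"
  obtain l where l: "\<Psi> i l \<noteq> 0" "\<Phi> l j \<noteq> 0" using nz(1) by (rule mat_mult_nonzeroE)
  obtain m where m: "\<Psi> i m \<noteq> 0" "\<Phi> m k \<noteq> 0" using nz(2) by (rule mat_mult_nonzeroE)
  have "m = l" by (rule submonomialD(3)[OF \<Psi> l(1) m(1)])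
  with m(2) have "\<Phi> l k \<noteq> 0" by simp
  then show "k = j" by (rule submonomialD(3)[OF \<Phi> l(2)])
next
  fix i j k assume nz: "mat_mult T \<Psi> \<Phi> i j \<noteq> 0" "mat_mult T \<Psi> \<Phi> k j \<noteq> 0"
  obtain l where l: "\<Psi> i l \<noteq> 0" "\<Phi> l j \<noteq> 0" using nz(1) by (rule mat_mult_nonzeroE)
  obtain m where m: "\<Psi> k m \<noteq> 0" "\<Phi> m j \<noteq> 0" using nz(2) by (rule mat_mult_nonzeroE)
  have "m = l" by (rule submonomialD(4)[OF \<Phi> l(2) m(2)])
  with m(1) have "\<Psi> k l \<noteq> 0" by simp
  then show "k = i" by (rule submonomialD(4)[OF \<Psi> l(1)])
qed

lemma mat_apply_mat_mult:
  fixes \<Phi> :: "'t \<Rightarrow> 's \<Rightarrow> 'a::idyll"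
  assumes \<Psi>: "submonomial U T \<Psi>" and \<Phi>: "submonomial T S \<Phi>"
  shows "mat_apply S (mat_mult T \<Psi> \<Phi>) X = mat_apply T \<Psi> (mat_apply S \<Phi> X)"
proof
  fix i
  note \<Psi>\<Phi> = submonomial_mat_mult[OF assms]
  show "mat_apply S (mat_mult T \<Psi> \<Phi>) X i = mat_apply T \<Psi> (mat_apply S \<Phi> X) i"
  proof (cases "\<exists>j k. \<Psi> i j \<noteq> 0 \<and> \<Phi> j k \<noteq> 0")
    case True
    then obtain j k where jk: "\<Psi> i j \<noteq> 0" "\<Phi> j k \<noteq> 0" by blast
    then have "mat_mult T \<Psi> \<Phi> i k = \<Psi> i j * \<Phi> j k"
      by (simp add: mat_mult_column mat_apply_entry[OF \<Psi>])
    with jk show ?thesis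
      using mat_apply_entry[OF \<Psi>\<Phi>, of i k X]
      by (simp add: mat_apply_entry[OF \<Psi>] mat_apply_entry[OF \<Phi>] mult.assoc)
  next
    case False
    have "mat_apply S (mat_mult T \<Psi> \<Phi>) X i = 0"
    proof (rule ccontr)
      assume "mat_apply S (mat_mult T \<Psi> \<Phi>) X i \<noteq> 0"
      then obtain k where "mat_mult T \<Psi> \<Phi> i k \<noteq> 0" by (rule mat_apply_nonzeroE)
      then obtain j where "\<Psi> i j \<noteq> 0" "\<Phi> j k \<noteq> 0" by (rule mat_mult_nonzeroE)
      with False show False by blast
    qed
    moreover have "mat_apply T \<Psi> (mat_apply S \<Phi> X) i = 0"
    proof (rule ccontr)
      assume "mat_apply T \<Psi> (mat_apply S \<Phi> X) i \<noteq> 0"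
      then obtain j where j: "\<Psi> i j \<noteq> 0" "mat_apply S \<Phi> X j \<noteq> 0" by (rule mat_apply_nonzeroE)
      obtain k where "\<Phi> j k \<noteq> 0" using j(2) by (rule mat_apply_nonzeroE)
      with j(1) False show False by blast
    qed
    ultimately show ?thesis by simp
  qed
qed

lemma mat_mult_assoc:
  fixes \<Phi> :: "'t \<Rightarrow> 's \<Rightarrow> 'a::idyll"
  assumes "submonomial V U \<Theta>" "submonomial U T \<Psi>"
  shows "mat_mult U \<Theta> (mat_mult T \<Psi> \<Phi>) = mat_mult T (mat_mult U \<Theta> \<Psi>) \<Phi>"
proof (intro ext)
  fix i k
  have "mat_mult T (mat_mult U \<Theta> \<Psi>) \<Phi> i k = mat_apply U \<Theta> (mat_apply T \<Psi> (\<lambda>j. \<Phi> j k)) i"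
    by (simp add: mat_mult_column mat_apply_mat_mult[OF assms])
  then show "mat_mult U \<Theta> (mat_mult T \<Psi> \<Phi>) i k = mat_mult T (mat_mult U \<Theta> \<Psi>) \<Phi> i k"
    by (simp add: mat_mult_column[abs_def])
qed

lemma submonomial_mat_id: "submonomial S S (mat_id S :: 's \<Rightarrow> 's \<Rightarrow> 'a::idyll)"
  by (auto simp: submonomial_def mat_id_def Uniq_def)

lemma mat_apply_mat_id:
  fixes X :: "'s \<Rightarrow> 'a::idyll"
  assumes "X \<in> vecs_on S"
  shows "mat_apply S (mat_id S) X = X"
proof
  fix i
  show "mat_apply S (mat_id S) X i = X i"
  proof (cases "i \<in> S")
    case True
    then show ?thesis using mat_apply_entry[OF submonomial_mat_id[of S], of i i X] by (simp add: mat_id_def)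
  next
    case False
    then have "mat_apply S (mat_id S) X i = 0" using mat_apply_vecs_on[OF submonomial_mat_id[of S], of X]
      by (simp add: vecs_on_def)
    then show ?thesis using assms False by (simp add: vecs_on_def)
  qed
qed

lemma mat_transpose_mat_id: "mat_transpose (mat_id S) = mat_id S"
  by (auto simp: mat_transpose_def mat_id_def fun_eq_iff)

lemma mat_transpose_mat_mult:
  fixes \<Phi> :: "'t \<Rightarrow> 's \<Rightarrow> 'a::idyll"
  shows "mat_transpose (mat_mult T \<Psi> \<Phi>) = mat_mult T (mat_transpose \<Phi>) (mat_transpose \<Psi>)"
  by (auto simp: mat_transpose_def mat_mult_def fun_eq_iff mult.commute)

lemma mat_transpose_mat_transpose: "mat_transpose (mat_transpose \<Phi>) = \<Phi>"
  by (simp add: mat_transpose_def fun_eq_iff)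

lemma mat_mult_mat_id_left:
  fixes \<Phi> :: "'t \<Rightarrow> 's \<Rightarrow> 'a::idyll"
  assumes "submonomial T S \<Phi>"
  shows "mat_mult T (mat_id T) \<Phi> = \<Phi>"
proof (intro ext)
  fix i k
  have "(\<lambda>j. \<Phi> j k) \<in> vecs_on T" using submonomialD(1)[OF assms] by (auto simp: vecs_on_def)
  then show "mat_mult T (mat_id T) \<Phi> i k = \<Phi> i k" by (simp add: mat_mult_column mat_apply_mat_id)
qed

lemma mat_mult_mat_id_right:
  fixes \<Phi> :: "'t \<Rightarrow> 's \<Rightarrow> 'a::idyll"
  assumes "submonomial T S \<Phi>"
  shows "mat_mult S \<Phi> (mat_id S) = \<Phi>"
  using mat_mult_mat_id_left[OF submonomial_transpose[OF assms]]
  by (metis mat_transpose_mat_id mat_transpose_mat_mult mat_transpose_mat_transpose)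

lemma F_morphism_mat_id: "F_matroid M \<Longrightarrow> F_morphism M M (mat_id (ground M))"
  by (auto simp: F_morphism_def submonomial_mat_id vectors_def mat_apply_mat_id)

lemma F_morphism_mat_mult:
  assumes \<Phi>: "F_morphism L N \<Phi>" and \<Psi>: "F_morphism N M \<Psi>"
  shows "F_morphism L M (mat_mult (ground N) \<Psi> \<Phi>)"
proof -
  have sub: "submonomial (ground M) (ground N) \<Psi>" "submonomial (ground N) (ground L) \<Phi>"
    using assms by (auto simp: F_morphism_def)
  show ?thesis
    using assms unfolding F_morphism_def
    by (auto simp: mat_apply_mat_mult[OF sub] submonomial_mat_mult[OF sub] image_subset_iff)
qed

lemma category_Mat: "category (Mat :: (('e::linorder, 'a::idyll) matroid, 'e \<Rightarrow> 'e \<Rightarrow> 'a) category_data)"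
proof (rule category.intro; simp add: Mat_def)
  show "F_morphism X X (mat_id (ground X))" if "F_matroid X" for X :: "('e, 'a) matroid"
    using that by (rule F_morphism_mat_id)
  show "F_morphism X Z (mat_mult (ground Y) g f)" if "F_morphism X Y f" "F_morphism Y Z g"
    for X Y Z :: "('e, 'a) matroid" and f g
    using that by (rule F_morphism_mat_mult)
qed (auto simp: F_morphism_def mat_mult_mat_id_left mat_mult_mat_id_right intro!: mat_mult_assoc)

theorem propositionB:
  assumes "perfect_idyll TYPE('a::idyll)"
  shows "(\<forall>(N :: ('s::linorder, 'a) matroid) (M :: ('t::linorder, 'a) matroid) \<Phi>.
            F_morphism N M \<Phi> \<longrightarrow> F_morphism (dual M) (dual N) (mat_transpose \<Phi>)) \<and>
         contravariant_functor (Mat :: (('e::linorder, 'a) matroid, 'e \<Rightarrow> 'e \<Rightarrow> 'a) category_data) Mat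
            dual (\<lambda>N M. mat_transpose) \<and>
         squares_to_identity (Mat :: (('e, 'a) matroid, 'e \<Rightarrow> 'e \<Rightarrow> 'a) category_data)
            dual (\<lambda>N M. mat_transpose)"
proof (intro conjI allI impI)
  show "F_morphism (dual M) (dual N) (mat_transpose \<Phi>)" if "F_morphism N M \<Phi>"
    for N :: "('s, 'a) matroid" and M :: "('t, 'a) matroid" and \<Phi>
    by (rule F_morphism_transpose[OF assms that])
  have "contravariant_functor_axioms Mat Mat (dual :: ('e, 'a) matroid \<Rightarrow> _) (\<lambda>N M. mat_transpose)"
    by (rule contravariant_functor_axioms.intro)
      (auto simp: Mat_def F_matroid_dual F_morphism_transpose[OF assms]
        mat_transpose_mat_id mat_transpose_mat_mult)
  then show "contravariant_functor (Mat :: (('e, 'a) matroid, _) category_data) Mat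
      dual (\<lambda>N M. mat_transpose)"
    by (intro contravariant_functor.intro category_Mat)
  show "squares_to_identity (Mat :: (('e, 'a) matroid, 'e \<Rightarrow> 'e \<Rightarrow> 'a) category_data)
      dual (\<lambda>N M. mat_transpose)"
    by (auto simp: squares_to_identity_def Mat_def dual_dual mat_transpose_mat_transpose)
qed

end
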